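(* Let $\{(X_n,d_n)\}$ be a sequence of bounded Polish metric spaces and let $C>0$. If $\{(X_n,d_n)\}$ converges in the Gromov-Hausdorff topology to a bounded Polish metric space $(X,d)$, then $\{(\mathcal{M}_p^C(X_n),W_p^{a,b})\}$ converges in the Gromov-Hausdorff topology to $(\mathcal{M}_p^C(X),W_p^{a,b})$ for every $a,b>0$ and $p\ge1$.
   Context: A Polish metric space is a complete separable metric space. The Hausdorff distance between subsets $S,T$ of a metric space $Z$ is $d_H(S,T)=\inf\{\varepsilon>0: S\subset B_\varepsilon(T),\ T\subset B_\varepsilon(S)\}$, where $B_\varepsilon(S)=\bigcup_{x\in S}B_\varepsilon(x)$. The Gromov-Hausdorff distance $d_{GH}(X,Y)$ is the infimum of $r>0$ such that there are a metric space $Z$ and subspaces $X',Y'\subset Z$ isometric to $X,Y$ respectively with $d_H(X',Y')<r$. Convergence in the Gromov-Hausdorff topology means $d_{GH}\to0$. $\mathcal{M}(X)$ is the set of nonnegative Borel measures on $X$ with finite mass; $\mathcal{M}_p(X)$ ($p\ge1$) is the set of $\mu\in\mathcal{M}(X)$ with $\int_X d(x,x_0)^p\,d\mu(x)<\infty$ for some (equivalently any) $x_0\in X$ (all of $\mathcal{M}(X)$ when $X$ is bounded). For $\mu\in\mathcal{M}(X)$, $|\mu|:=\mu(X)$, and $|\mu-\nu|$ denotes the total variation mass of the signed measure $\mu-\nu$. $\mathcal{M}_p^C(X):=\{\mu\in\mathcal{M}_p(X):|\mu|\le C\}$. For $\mu,\nu\in\mathcal{M}(X)$ with $|\mu|=|\nu|$,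 $\Pi(\mu,\nu)$ is the set of Borel probability measures $\pi$ on $X\times X$ with $|\mu|\pi(A\times X)=\mu(A)$ and $|\nu|\pi(X\times B)=\nu(B)$ for all Borel $A,B\subset X$; for $\mu,\nu\in\mathcal{M}_p(X)$ with $|\mu|=|\nu|$, $W_p(\mu,\nu):=\left(|\mu|\inf_{\pi\in\Pi(\mu,\nu)}\int_{X\times X}d(x,y)^p\,d\pi(x,y)\right)^{1/p}$. The generalized Wasserstein distance on $\mathcal{M}(X)$ is $$W_p^{a,b}(\mu,\nu):=\inf\{a|\mu-\widetilde\mu|+a|\nu-\widetilde\nu|+b\,W_p(\widetilde\mu,\widetilde\nu)\;:\;\widetilde\mu,\widetilde\nu\in\mathcal{M}_p(X),\ |\widetilde\mu|=|\widetilde\nu|\}.$$ *)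

theory Defs
  imports "HOL-Probability.Probability"
begin

section \<open>Gromov-Hausdorff distance\<close>

text \<open>
  Metric spaces are given by a carrier set and a distance function satisfying the library
  predicate \<^const>\<open>Metric_space\<close>.
\<close>

definition bounded_polish_metric :: "'a set \<Rightarrow> ('a \<Rightarrow> 'a \<Rightarrow> real) \<Rightarrow> bool" where
  "bounded_polish_metric X d \<longleftrightarrow>
     Metric_space X d \<and> Metric_space.mcomplete X d \<and>
     separable_space (Metric_space.mtopology X d) \<and> Metric_space.mbounded X d X"

definition nbhd :: "'a set \<Rightarrow> ('a \<Rightarrow> 'a \<Rightarrow> real) \<Rightarrow> real \<Rightarrow> 'a set \<Rightarrow> 'a set" where
  "nbhd Z d \<epsilon> S = (\<Union>x\<in>S. Metric_space.mball Z d x \<epsilon>)"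

text \<open>Extended-valued: the infimum of the empty set is \<open>\<infinity>\<close>.\<close>

definition hausdorff_dist ::
  "'a set \<Rightarrow> ('a \<Rightarrow> 'a \<Rightarrow> real) \<Rightarrow> 'a set \<Rightarrow> 'a set \<Rightarrow> ennreal" where
  "hausdorff_dist Z d S T =
     Inf (ennreal ` {\<epsilon>. 0 < \<epsilon> \<and> S \<subseteq> nbhd Z d \<epsilon> T \<and> T \<subseteq> nbhd Z d \<epsilon> S})"

definition isometric ::
  "'a set \<Rightarrow> ('a \<Rightarrow> 'a \<Rightarrow> real) \<Rightarrow> 'b set \<Rightarrow> ('b \<Rightarrow> 'b \<Rightarrow> real) \<Rightarrow> bool" where
  "isometric X d Y e \<longleftrightarrow>
     (\<exists>f. bij_betw f X Y \<and> (\<forall>x\<in>X. \<forall>x'\<in>X. e (f x) (f x') = d x x'))"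

text \<open>
  The ambient metric space \<open>Z\<close> ranges over all metric spaces whose carrier is a subset of the
  sum type. This is no restriction, since \<open>Z\<close> may always be replaced by the union of the two
  isometric copies, which embeds into the sum type; see \<open>GH_dist_le\<close> below for ambient spaces
  in an arbitrary type.
\<close>

definition GH_dist ::
  "'a set \<Rightarrow> ('a \<Rightarrow> 'a \<Rightarrow> real) \<Rightarrow> 'b set \<Rightarrow> ('b \<Rightarrow> 'b \<Rightarrow> real) \<Rightarrow> ennreal" where
  "GH_dist X d Y e =
     Inf (ennreal ` {r. 0 < r \<and>
       (\<exists>(Z :: ('a + 'b) set) \<rho> X' Y'.
          Metric_space Z \<rho> \<and> X' \<subseteq> Z \<and> Y' \<subseteq> Z \<and>
          isometric X d X' \<rho> \<and> isometric Y e Y' \<rho> \<and>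
          hausdorff_dist Z \<rho> X' Y' < ennreal r)})"

definition GH_converges ::
  "(nat \<Rightarrow> 'a set) \<Rightarrow> (nat \<Rightarrow> 'a \<Rightarrow> 'a \<Rightarrow> real) \<Rightarrow> 'b set \<Rightarrow> ('b \<Rightarrow> 'b \<Rightarrow> real) \<Rightarrow> bool" where
  "GH_converges X d Y e \<longleftrightarrow> (\<lambda>n. GH_dist (X n) (d n) Y e) \<longlonglongrightarrow> 0"

lemma GH_dist_le:
  fixes X :: "'a set" and Y :: "'b set" and Z :: "'c set"
  assumes Z: "Metric_space Z \<rho>" and sub: "X' \<subseteq> Z" "Y' \<subseteq> Z"
    and iX: "isometric X d X' \<rho>" and iY: "isometric Y e Y' \<rho>"
    and r: "0 < r" "hausdorff_dist Z \<rho> X' Y' < ennreal r"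
  shows "GH_dist X d Y e \<le> ennreal r"
proof -
  interpret Z: Metric_space Z \<rho> by (rule Z)
  obtain f where f: "bij_betw f X X'" "\<And>x x'. x \<in> X \<Longrightarrow> x' \<in> X \<Longrightarrow> \<rho> (f x) (f x') = d x x'"
    using iX unfolding isometric_def by blast
  obtain g where g: "bij_betw g Y Y'" "\<And>x x'. x \<in> Y \<Longrightarrow> x' \<in> Y \<Longrightarrow> \<rho> (g x) (g x') = e x x'"
    using iY unfolding isometric_def by blast
  define h :: "'c \<Rightarrow> 'a + 'b" where
    "h = (\<lambda>z. if z \<in> X' then Inl (inv_into X f z) else Inr (inv_into Y g z))"
  define W where "W = X' \<union> Y'"
  define k where "k = inv_into W h"
  define Z2 where "Z2 = h ` W"
  define \<sigma> where "\<sigma> = (\<lambda>u v. \<rho> (k u) (k v))"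
  have "inj_on (inv_into X f) X'" "inj_on (inv_into Y g) Y'"
    using f(1) g(1) by (simp_all add: bij_betw_def inj_on_inv_into)
  then have inj: "inj_on h W"
    unfolding h_def W_def inj_on_def by (auto split: if_splits)
  have kh: "k (h z) = z" if "z \<in> W" for z
    using that inj by (simp add: k_def)
  have WZ: "W \<subseteq> Z" using sub by (auto simp: W_def)
  have Z2: "Metric_space Z2 \<sigma>"
    using WZ by unfold_locales
      (auto simp: \<sigma>_def Z2_def kh Z.commute subset_iff intro!: Z.triangle)
  have \<sigma>h: "\<sigma> (h z) (h w) = \<rho> z w" if "z \<in> W" "w \<in> W" for z w
    using that by (simp add: \<sigma>_def kh)
  have X'W: "X' \<subseteq> W" "Y' \<subseteq> W" by (auto simp: W_def)
  have comp: "isometric A c (h ` A') \<sigma>" if iso: "isometric A c A' \<rho>" and A': "A' \<subseteq> W"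
    for A' and A :: "'d set" and c
  proof -
    obtain q where q: "bij_betw q A A'"
      "\<forall>x\<in>A. \<forall>x'\<in>A. \<rho> (q x) (q x') = c x x'"
      using iso unfolding isometric_def by blast
    have "bij_betw h A' (h ` A')" using inj A' by (meson bij_betw_imageI inj_on_subset)
    then have "bij_betw (h \<circ> q) A (h ` A')" using q(1) by (rule bij_betw_trans[rotated])
    moreover have "q x \<in> W" if "x \<in> A" for x using that q(1) A' by (auto simp: bij_betw_def)
    ultimately show ?thesis
      unfolding isometric_def using q(2) by (intro exI[of _ "h \<circ> q"]) (simp add: \<sigma>h)
  qed
  have isoX: "isometric X d (h ` X') \<sigma>" using comp[OF iX X'W(1)] .
  have isoY: "isometric Y e (h ` Y') \<sigma>" using comp[OF iY X'W(2)] .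
  have nb: "h ` S \<subseteq> nbhd Z2 \<sigma> \<epsilon> (h ` T)"
    if nST: "S \<subseteq> nbhd Z \<rho> \<epsilon> T" and "S \<subseteq> W" "T \<subseteq> W" for S T \<epsilon>
  proof
    fix u assume "u \<in> h ` S"
    then obtain s where s: "s \<in> S" "u = h s" by blast
    then obtain t where t: "t \<in> T" "s \<in> Metric_space.mball Z \<rho> t \<epsilon>"
      using nST s(1) unfolding nbhd_def by blast
    have tW: "t \<in> W" and sW: "s \<in> W" using t s \<open>S \<subseteq> W\<close> \<open>T \<subseteq> W\<close> by auto
    have lt: "\<sigma> (h t) (h s) < \<epsilon>" using t(2) \<sigma>h[OF tW sW] by auto
    have "h t \<in> Z2" "h s \<in> Z2" using tW sW by (auto simp: Z2_def)
    then have "h s \<in> Metric_space.mball Z2 \<sigma> (h t) \<epsilon>"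
      using lt by (simp add: Metric_space.in_mball[OF Z2])
    then show "u \<in> nbhd Z2 \<sigma> \<epsilon> (h ` T)"
      using s(2) t(1) unfolding nbhd_def by blast
  qed
  have "hausdorff_dist Z2 \<sigma> (h ` X') (h ` Y') \<le> hausdorff_dist Z \<rho> X' Y'"
    unfolding hausdorff_dist_def
    by (intro Inf_superset_mono image_mono) (use nb X'W in blast)
  then have "hausdorff_dist Z2 \<sigma> (h ` X') (h ` Y') < ennreal r" using r(2) by (rule le_less_trans)
  moreover have "h ` X' \<subseteq> Z2" "h ` Y' \<subseteq> Z2" using X'W by (auto simp: Z2_def)
  ultimately show ?thesis
    unfolding GH_dist_def using r(1) Z2 isoX isoY by (intro Inf_lower imageI) blast
qed

section \<open>Spaces of measures and the generalized Wasserstein distance\<close>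

definition borel_on :: "'a topology \<Rightarrow> 'a measure" where
  "borel_on T = sigma (topspace T) {U. openin T U}"

definition finite_measures :: "'a set \<Rightarrow> ('a \<Rightarrow> 'a \<Rightarrow> real) \<Rightarrow> 'a measure set" where
  "finite_measures X d =
     {\<mu>. sets \<mu> = sets (borel_on (Metric_space.mtopology X d)) \<and> finite_measure \<mu>}"

definition mass :: "'a measure \<Rightarrow> real" where
  "mass \<mu> = measure \<mu> (space \<mu>)"

text \<open>
  The guard on nonemptiness makes the moment condition vacuous for \<open>X = {}\<close>, so that
  all finite measures are admitted for every bounded \<open>X\<close>.
\<close>

definition measures_p :: "'a set \<Rightarrow> ('a \<Rightarrow> 'a \<Rightarrow> real) \<Rightarrow> real \<Rightarrow> 'a measure set" where
  "measures_p X d p =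
     {\<mu> \<in> finite_measures X d.
        X \<noteq> {} \<longrightarrow> (\<exists>x0\<in>X. (\<integral>\<^sup>+x. ennreal (d x x0 powr p) \<partial>\<mu>) < \<infinity>)}"

definition measures_p_le :: "'a set \<Rightarrow> ('a \<Rightarrow> 'a \<Rightarrow> real) \<Rightarrow> real \<Rightarrow> real \<Rightarrow> 'a measure set" where
  "measures_p_le X d p C = {\<mu> \<in> measures_p X d p. mass \<mu> \<le> C}"

text \<open>
  Total variation mass of the signed measure \<open>\<mu> - \<nu>\<close>, for finite measures on the same
  \<open>\<sigma>\<close>-algebra: the supremum over finite measurable partitions of the space. The
  supremum is taken over sums bounded by \<open>mass \<mu> + mass \<nu>\<close>.
\<close>

definition tv_mass :: "'a measure \<Rightarrow> 'a measure \<Rightarrow> real" where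
  "tv_mass \<mu> \<nu> =
     (SUP P \<in> {P. finite P \<and> P \<subseteq> sets \<mu> \<and> disjoint P \<and> \<Union>P = space \<mu>}.
        \<Sum>A\<in>P. \<bar>measure \<mu> A - measure \<nu> A\<bar>)"

definition couplings ::
  "'a set \<Rightarrow> ('a \<Rightarrow> 'a \<Rightarrow> real) \<Rightarrow> 'a measure \<Rightarrow> 'a measure \<Rightarrow> ('a \<times> 'a) measure set" where
  "couplings X d \<mu> \<nu> =
     {\<pi>. prob_space \<pi> \<and>
         sets \<pi> = sets (borel_on
           (prod_topology (Metric_space.mtopology X d) (Metric_space.mtopology X d))) \<and>
         (\<forall>A \<in> sets (borel_on (Metric_space.mtopology X d)).
            mass \<mu> * measure \<pi> (A \<times> X) = measure \<mu> A) \<and>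
         (\<forall>B \<in> sets (borel_on (Metric_space.mtopology X d)).
            mass \<nu> * measure \<pi> (X \<times> B) = measure \<nu> B)}"

text \<open>
  For \<open>\<mu>, \<nu>\<close> of equal mass in \<^const>\<open>measures_p\<close> the infimum is finite, except for
  \<open>X = {}\<close> (no couplings), where both masses are \<open>0\<close> and the distance is \<open>0\<close>.
\<close>

definition wasserstein ::
  "'a set \<Rightarrow> ('a \<Rightarrow> 'a \<Rightarrow> real) \<Rightarrow> real \<Rightarrow> 'a measure \<Rightarrow> 'a measure \<Rightarrow> real" where
  "wasserstein X d p \<mu> \<nu> =
     (mass \<mu> * enn2real (INF \<pi> \<in> couplings X d \<mu> \<nu>.
        \<integral>\<^sup>+z. ennreal (d (fst z) (snd z) powr p) \<partial>\<pi>)) powr (1 / p)"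

definition gen_wasserstein ::
  "'a set \<Rightarrow> ('a \<Rightarrow> 'a \<Rightarrow> real) \<Rightarrow> real \<Rightarrow> real \<Rightarrow> real \<Rightarrow> 'a measure \<Rightarrow> 'a measure \<Rightarrow> real" where
  "gen_wasserstein X d p a b \<mu> \<nu> =
     Inf {a * tv_mass \<mu> \<mu>' + a * tv_mass \<nu> \<nu>' + b * wasserstein X d p \<mu>' \<nu>' | \<mu>' \<nu>'.
            \<mu>' \<in> measures_p X d p \<and> \<nu>' \<in> measures_p X d p \<and> mass \<mu>' = mass \<nu>'}"

end

theory Submission
  imports Defs
begin

text \<open>Two facts carry the proof.

  First, \<open>W\<^sub>p\<^sup>a\<^sup>,\<^sup>b\<close> really is a metric on the finite Borel measures of a bounded separable metric
  space; without this, no ambient metric space could contain an isometric copy of the measure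
  spaces. The hard axiom is the triangle inequality. Suppose \<open>\<mu>\<close> is moved to \<open>\<nu>\<close> through
  \<open>\<mu>\<^sub>1 \<rightarrow> \<nu>\<^sub>1\<close>, and \<open>\<nu>\<close> to \<open>\<eta>\<close> through \<open>\<nu>\<^sub>2 \<rightarrow> \<eta>\<^sub>2\<close>, the arrows denoting transport plans. The
  intermediate measures \<open>\<nu>\<^sub>1\<close> and \<open>\<nu>\<^sub>2\<close> differ, but \<open>|\<nu>\<^sub>1 - \<nu>\<^sub>2|\<close> has been paid for, since both are
  compared with \<open>\<nu>\<close>. So one may transport only the mass that the two have in common, and delete the
  rest on both sides. Instead of disintegrating the plans over the middle point, the space is cut
  into countably many Borel cells of small diameter, and two plans are joined by independent
  products over each cell, with weights such that a cell carries the mass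
  \<open>min (\<nu>\<^sub>1 cell) (\<nu>\<^sub>2 cell)\<close>. Middle points of the two plans then only agree up to the diameter of a
  cell, which Minkowski's inequality turns into an arbitrarily small error; and the deleted mass is
  \<open>\<Sum> |\<nu>\<^sub>1 cell - \<nu>\<^sub>2 cell|\<close>, which is a lower bound for the total variation of \<open>\<nu>\<^sub>1 - \<nu>\<^sub>2\<close>. This is lemma
  \<open>glue_transports\<close>. Definiteness (\<open>W_zero_imp_eq\<close>) holds because a plan of small cost moves
  little mass into a closed set from outside a given neighbourhood of it.

  Second, if \<open>X\<close> and \<open>Y\<close> are Gromov-Hausdorff close, there are Borel maps \<open>T : X \<rightarrow> Y\<close> and
  \<open>S : Y \<rightarrow> X\<close> that distort distances by at most \<open>e\<close> and are inverse to each other up to \<open>e\<close>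
  (\<open>measurable_close_point_map\<close>); they are Borel because they can be chosen with values in a
  countable dense set. Pushing measures forward does not increase total variation, and increases
  the transport part by at most a constant multiple of \<open>e\<close>, because near-optimal competitors for
  measures of mass at most \<open>C\<close> have mass at most \<open>4 C\<close> (\<open>W_distr_le\<close>). A measure differs from its
  image under the composition of \<open>S\<close> and \<open>T\<close> by a transport over distance at most \<open>e\<close>. Hence the
  push-forward by \<open>T\<close> is an approximate isometry between the two measure spaces with almost dense
  image, and such a map bounds the Gromov-Hausdorff distance (\<open>GH_dist_le_of_approximation\<close>).
  All constants depend on \<open>b\<close>, \<open>C\<close> and \<open>p\<close> only.\<close>

section \<open>Minkowski's inequality\<close>

lemma powr_convex_combination:
  fixes p s t u v :: real
  assumes "p \<ge> 1" "s \<ge> 0" "t \<ge> 0" "s + t = 1" "u \<ge> 0" "v \<ge> 0"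
  shows "(s * u + t * v) powr p \<le> s * u powr p + t * v powr p"
proof -
  have scale: "(r * w) powr p \<le> r * w powr p" if "0 \<le> r" "r \<le> 1" "0 \<le> w" for r w :: real
  proof -
    have "r powr p \<le> r powr 1"
      using that(1,2) assms(1) by (intro powr_mono') auto
    then show ?thesis
      using that by (auto simp: powr_mult intro!: mult_right_mono)
  qed
  consider "u = 0" | "v = 0" | "u > 0" "v > 0" using assms by linarith
  then show ?thesis
  proof cases
    case 1 then show ?thesis using scale[of t v] assms by simp
  next
    case 2 then show ?thesis using scale[of s u] assms by simp
  next
    case 3
    have "((1 - t) *\<^sub>R u + t *\<^sub>R v) powr p \<le> (1 - t) * u powr p + t * v powr p"
      by (rule convex_onD[OF powr_convex[OF assms(1)]]) (use assms 3 in auto)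
    moreover have "s = 1 - t" using assms by simp
    ultimately show ?thesis by simp
  qed
qed

text \<open>The triangle inequality of the \<open>L\<^sup>p\<close> norm, for upper bounds of the two norms. Writing
  \<open>(f + g) / (A + B)\<close> as the convex combination of \<open>f / A\<close> and \<open>g / B\<close> with weights
  \<open>A / (A + B)\<close> and \<open>B / (A + B)\<close> and using convexity of the power gives it pointwise, before
  integration. The bounds are positive, so no case distinction on vanishing norms arises.\<close>

lemma Minkowski_powr_bound:
  fixes f g :: "'a \<Rightarrow> real"
  assumes p: "p \<ge> 1" and A: "A > 0" and B: "B > 0"
    and [measurable]: "f \<in> borel_measurable M" "g \<in> borel_measurable M"
    and f0: "\<And>x. f x \<ge> 0" and g0: "\<And>x. g x \<ge> 0"
    and fA: "(\<integral>\<^sup>+x. ennreal (f x powr p) \<partial>M) \<le> ennreal (A powr p)"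
    and gB: "(\<integral>\<^sup>+x. ennreal (g x powr p) \<partial>M) \<le> ennreal (B powr p)"
  shows "(\<integral>\<^sup>+x. ennreal ((f x + g x) powr p) \<partial>M) \<le> ennreal ((A + B) powr p)"
proof -
  define S where "S = (A + B) powr p"
  define c where "c = S * (A / (A + B)) / A powr p"
  define e where "e = S * (B / (A + B)) / B powr p"
  have ce: "c \<ge> 0" "e \<ge> 0" using A B by (simp_all add: c_def e_def S_def)
  have pw: "(f x + g x) powr p \<le> c * f x powr p + e * g x powr p" for x
  proof -
    have eq: "f x + g x = (A + B) * (A / (A + B) * (f x / A) + B / (A + B) * (g x / B))"
    proof -
      have "A / (A + B) * (f x / A) + B / (A + B) * (g x / B) = (f x + g x) / (A + B)"
        using A B by (simp add: add_divide_distrib)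
      then show ?thesis using A B by simp
    qed
    have "(f x + g x) powr p
        = S * (A / (A + B) * (f x / A) + B / (A + B) * (g x / B)) powr p"
      unfolding S_def by (subst eq, rule powr_mult)
    also have "\<dots> \<le> S * (A / (A + B) * (f x / A) powr p + B / (A + B) * (g x / B) powr p)"
      using A B p f0[of x] g0[of x]
      by (intro mult_left_mono powr_convex_combination) (auto simp: S_def add_divide_distrib[symmetric])
    also have "\<dots> = c * f x powr p + e * g x powr p"
      by (simp add: c_def e_def powr_divide distrib_left)
    finally show ?thesis .
  qed
  have "(\<integral>\<^sup>+x. ennreal ((f x + g x) powr p) \<partial>M)
      \<le> (\<integral>\<^sup>+x. ennreal c * ennreal (f x powr p) + ennreal e * ennreal (g x powr p) \<partial>M)"
    using ce by (intro nn_integral_mono)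
      (simp add: pw ennreal_mult[symmetric] ennreal_plus[symmetric] del: ennreal_plus)
  also have "\<dots> = ennreal c * (\<integral>\<^sup>+x. ennreal (f x powr p) \<partial>M)
                 + ennreal e * (\<integral>\<^sup>+x. ennreal (g x powr p) \<partial>M)"
    by (simp add: nn_integral_add nn_integral_cmult)
  also have "\<dots> \<le> ennreal c * ennreal (A powr p) + ennreal e * ennreal (B powr p)"
    by (intro add_mono mult_left_mono fA gB) auto
  also have "\<dots> = ennreal (c * A powr p + e * B powr p)"
    using ce by (simp add: ennreal_mult ennreal_plus)
  also have "c * A powr p + e * B powr p = S"
  proof -
    have "c * A powr p + e * B powr p = S * (A / (A + B)) + S * (B / (A + B))"
      using A B by (simp add: c_def e_def)
    also have "\<dots> = S * ((A + B) / (A + B))" by (simp only: distrib_left add_divide_distrib)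
    finally show ?thesis using A B by simp
  qed
  finally show ?thesis by (simp add: S_def)
qed

section \<open>Total variation\<close>

definition partitions :: "'a measure \<Rightarrow> 'a set set set" where
  "partitions \<mu> = {P. finite P \<and> P \<subseteq> sets \<mu> \<and> disjoint P \<and> \<Union>P = space \<mu>}"

lemma sum_measure_partition:
  assumes "finite_measure \<mu>" "P \<in> partitions \<mu>"
  shows "(\<Sum>A\<in>P. measure \<mu> A) = mass \<mu>"
proof -
  interpret finite_measure \<mu> by fact
  have "measure \<mu> (\<Union>A\<in>P. A) = (\<Sum>A\<in>P. measure \<mu> A)"
    using assms(2) by (intro finite_measure_finite_Union)
      (auto simp: partitions_def disjoint_family_on_def disjoint_def)
  then show ?thesis using assms(2) by (simp add: mass_def partitions_def)
qed

lemma trivial_partition: "{space \<mu>} \<in> partitions \<mu>"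
  by (auto simp: partitions_def disjoint_def)

lemma tv_mass_alt: "tv_mass \<mu> \<nu> = (SUP P\<in>partitions \<mu>. \<Sum>A\<in>P. \<bar>measure \<mu> A - measure \<nu> A\<bar>)"
  by (simp add: tv_mass_def partitions_def)

lemma partition_sum_le_masses:
  assumes "finite_measure \<mu>" "finite_measure \<nu>" "sets \<mu> = sets \<nu>" "P \<in> partitions \<mu>"
  shows "(\<Sum>A\<in>P. \<bar>measure \<mu> A - measure \<nu> A\<bar>) \<le> mass \<mu> + mass \<nu>"
proof -
  have "P \<in> partitions \<nu>"
    using assms(3,4) sets_eq_imp_space_eq[OF assms(3)] by (simp add: partitions_def)
  then have "mass \<mu> + mass \<nu> = (\<Sum>A\<in>P. measure \<mu> A + measure \<nu> A)"
    using assms by (simp add: sum.distrib sum_measure_partition)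
  moreover have "\<bar>measure \<mu> A - measure \<nu> A\<bar> \<le> measure \<mu> A + measure \<nu> A" for A
    using measure_nonneg[of \<mu> A] measure_nonneg[of \<nu> A] by linarith
  ultimately show ?thesis by (simp add: sum_mono)
qed

lemma partition_sum_le_tv_mass:
  assumes "finite_measure \<mu>" "finite_measure \<nu>" "sets \<mu> = sets \<nu>" "P \<in> partitions \<mu>"
  shows "(\<Sum>A\<in>P. \<bar>measure \<mu> A - measure \<nu> A\<bar>) \<le> tv_mass \<mu> \<nu>"
  unfolding tv_mass_alt
  by (rule cSUP_upper[OF assms(4)])
     (use partition_sum_le_masses[OF assms(1-3)] in \<open>auto simp: bdd_above_def\<close>)

lemma tv_mass_leI:
  assumes "\<And>P. P \<in> partitions \<mu> \<Longrightarrow> (\<Sum>A\<in>P. \<bar>measure \<mu> A - measure \<nu> A\<bar>) \<le> c"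
  shows "tv_mass \<mu> \<nu> \<le> c"
  unfolding tv_mass_alt by (rule cSUP_least) (use assms trivial_partition in auto)

lemma tv_mass_refl [simp]: "tv_mass \<mu> \<mu> = 0"
proof -
  have "partitions \<mu> \<noteq> {}" using trivial_partition by auto
  then show ?thesis by (simp add: tv_mass_alt)
qed

lemma tv_mass_triangle:
  assumes "finite_measure \<mu>" "finite_measure \<nu>" "finite_measure \<eta>"
    and "sets \<mu> = sets \<nu>" "sets \<nu> = sets \<eta>"
  shows "tv_mass \<mu> \<eta> \<le> tv_mass \<mu> \<nu> + tv_mass \<nu> \<eta>"
proof (rule tv_mass_leI)
  fix P assume P: "P \<in> partitions \<mu>"
  then have P': "P \<in> partitions \<nu>"
    using assms(4) sets_eq_imp_space_eq[OF assms(4)] by (simp add: partitions_def)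
  have "(\<Sum>A\<in>P. \<bar>measure \<mu> A - measure \<eta> A\<bar>)
      \<le> (\<Sum>A\<in>P. \<bar>measure \<mu> A - measure \<nu> A\<bar> + \<bar>measure \<nu> A - measure \<eta> A\<bar>)"
    by (intro sum_mono) linarith
  also have "\<dots> \<le> tv_mass \<mu> \<nu> + tv_mass \<nu> \<eta>"
    unfolding sum.distrib using assms P P' by (intro add_mono partition_sum_le_tv_mass) auto
  finally show "(\<Sum>A\<in>P. \<bar>measure \<mu> A - measure \<eta> A\<bar>) \<le> tv_mass \<mu> \<nu> + tv_mass \<nu> \<eta>" .
qed

lemma tv_mass_le_masses:
  assumes "finite_measure \<mu>" "finite_measure \<nu>" "sets \<mu> = sets \<nu>"
  shows "tv_mass \<mu> \<nu> \<le> mass \<mu> + mass \<nu>"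
  using partition_sum_le_masses[OF assms] by (rule tv_mass_leI)

text \<open>The family need not cover the space, nor consist of distinct or nonempty sets: equal members are
  empty and contribute nothing, and the complement of the union completes a partition.\<close>

lemma disjoint_family_sum_le_tv_mass:
  assumes "finite_measure \<mu>" "finite_measure \<nu>" "sets \<mu> = sets \<nu>"
    and I: "finite I" "disjoint_family_on A I" "\<And>i. i \<in> I \<Longrightarrow> A i \<in> sets \<mu>"
  shows "(\<Sum>i\<in>I. \<bar>measure \<mu> (A i) - measure \<nu> (A i)\<bar>) \<le> tv_mass \<mu> \<nu>"
proof -
  define R where "R = space \<mu> - (\<Union>i\<in>I. A i)"
  define P where "P = insert R (A ` I)"
  let ?f = "\<lambda>B. \<bar>measure \<mu> B - measure \<nu> B\<bar>"
  have sub: "A i \<subseteq> space \<mu>" if "i \<in> I" for i using I(3)[OF that] by (rule sets.sets_into_space)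
  have "disjoint (A ` I)"
    using I(2) unfolding disjoint_def disjoint_family_on_def by (metis imageE)
  moreover have "R \<inter> A i = {}" if "i \<in> I" for i using that by (auto simp: R_def)
  ultimately have "disjoint P" unfolding P_def disjoint_def by blast
  moreover have "\<Union>P = space \<mu>" using sub by (auto simp: P_def R_def)
  moreover have "R \<in> sets \<mu>" using I by (auto simp: R_def)
  ultimately have P: "P \<in> partitions \<mu>"
    using I by (auto simp: partitions_def P_def)
  have "(\<Sum>i\<in>I. ?f (A i)) = (\<Sum>B\<in>A ` I. ?f B)"
  proof (rule sum.reindex_nontrivial[symmetric, unfolded o_def, OF I(1)])
    fix i j assume "i \<in> I" "j \<in> I" "i \<noteq> j" "A i = A j"
    then have "A i = {}" using I(2) unfolding disjoint_family_on_def by blast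
    then show "?f (A i) = 0" by simp
  qed
  also have "\<dots> \<le> (\<Sum>B\<in>P. ?f B)"
    unfolding P_def using I(1) by (intro sum_mono2) auto
  also have "\<dots> \<le> tv_mass \<mu> \<nu>" by (rule partition_sum_le_tv_mass) (use assms P in auto)
  finally show ?thesis .
qed

lemma measure_diff_le_tv_mass:
  assumes "finite_measure \<mu>" "finite_measure \<nu>" "sets \<mu> = sets \<nu>" "A \<in> sets \<mu>"
  shows "\<bar>measure \<mu> A - measure \<nu> A\<bar> \<le> tv_mass \<mu> \<nu>"
  using disjoint_family_sum_le_tv_mass[OF assms(1-3), of "{()}" "\<lambda>_. A"] assms(4)
  by (simp add: disjoint_family_on_def)

lemma tv_mass_nonneg:
  assumes "finite_measure \<mu>" "finite_measure \<nu>" "sets \<mu> = sets \<nu>"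
  shows "0 \<le> tv_mass \<mu> \<nu>"
  using measure_diff_le_tv_mass[OF assms, of "{}"] by simp

lemma mass_diff_le_tv_mass:
  assumes "finite_measure \<mu>" "finite_measure \<nu>" "sets \<mu> = sets \<nu>"
  shows "\<bar>mass \<mu> - mass \<nu>\<bar> \<le> tv_mass \<mu> \<nu>"
  using measure_diff_le_tv_mass[OF assms sets.top] sets_eq_imp_space_eq[OF assms(3)]
  by (simp add: mass_def)

lemma tv_mass_dominated:
  assumes "finite_measure \<mu>" "finite_measure \<nu>" "sets \<mu> = sets \<nu>"
    and "\<And>A. A \<in> sets \<mu> \<Longrightarrow> measure \<nu> A \<le> measure \<mu> A"
  shows "tv_mass \<mu> \<nu> \<le> mass \<mu> - mass \<nu>"
proof (rule tv_mass_leI)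
  fix P assume P: "P \<in> partitions \<mu>"
  then have P': "P \<in> partitions \<nu>"
    using assms(3) sets_eq_imp_space_eq[OF assms(3)] by (simp add: partitions_def)
  have "(\<Sum>A\<in>P. \<bar>measure \<mu> A - measure \<nu> A\<bar>) = (\<Sum>A\<in>P. measure \<mu> A - measure \<nu> A)"
    using assms(4) P by (intro sum.cong refl) (force simp: partitions_def)
  also have "\<dots> = mass \<mu> - mass \<nu>"
    using assms P P' by (simp add: sum_subtractf sum_measure_partition)
  finally show "(\<Sum>A\<in>P. \<bar>measure \<mu> A - measure \<nu> A\<bar>) \<le> mass \<mu> - mass \<nu>" by simp
qed

lemma tv_mass_distr_le:
  assumes "finite_measure \<mu>" "finite_measure \<nu>" "sets \<mu> = sets \<nu>" and T: "T \<in> measurable \<mu> N"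
  shows "tv_mass (distr \<mu> N T) (distr \<nu> N T) \<le> tv_mass \<mu> \<nu>"
proof (rule tv_mass_leI)
  fix P assume P: "P \<in> partitions (distr \<mu> N T)"
  have T': "T \<in> measurable \<nu> N" using T measurable_cong_sets[OF assms(3) refl] by auto
  have sp: "space \<nu> = space \<mu>" using sets_eq_imp_space_eq[OF assms(3)] by simp
  have PN: "A \<in> sets N" if "A \<in> P" for A using P that by (auto simp: partitions_def)
  have "(\<Sum>A\<in>P. \<bar>measure (distr \<mu> N T) A - measure (distr \<nu> N T) A\<bar>)
      = (\<Sum>A\<in>P. \<bar>measure \<mu> (T -` A \<inter> space \<mu>) - measure \<nu> (T -` A \<inter> space \<mu>)\<bar>)"
    using PN T T' by (intro sum.cong refl) (simp add: measure_distr sp)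
  also have "\<dots> \<le> tv_mass \<mu> \<nu>"
  proof (rule disjoint_family_sum_le_tv_mass[OF assms(1-3)])
    show "finite P" using P by (simp add: partitions_def)
    show "disjoint_family_on (\<lambda>A. T -` A \<inter> space \<mu>) P"
      using P unfolding partitions_def disjoint_family_on_def disjoint_def by blast
    show "T -` A \<inter> space \<mu> \<in> sets \<mu>" if "A \<in> P" for A
      using measurable_sets[OF T PN[OF that]] .
  qed
  finally show "(\<Sum>A\<in>P. \<bar>measure (distr \<mu> N T) A - measure (distr \<nu> N T) A\<bar>) \<le> tv_mass \<mu> \<nu>" .
qed

section \<open>Borel sets of a separable metric space\<close>

lemma space_borel_on [simp]: "space (borel_on T) = topspace T"
  by (simp add: borel_on_def space_measure_of_conv)

lemma sets_borel_on: "sets (borel_on T) = sigma_sets (topspace T) {U. openin T U}"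
  unfolding borel_on_def by (rule sets_measure_of) (auto dest: openin_subset)

lemma openin_sets_borel_on: "openin T U \<Longrightarrow> U \<in> sets (borel_on T)"
  by (simp add: sets_borel_on sigma_sets.Basic)

lemma closedin_sets_borel_on: "closedin T F \<Longrightarrow> F \<in> sets (borel_on T)"
  using sets.compl_sets[OF openin_sets_borel_on[of T "topspace T - F"]]
  by (auto simp: closedin_def double_diff)

lemma measurable_borel_onI:
  assumes "f \<in> space N \<rightarrow> topspace T"
    and "\<And>U. openin T U \<Longrightarrow> f -` U \<inter> space N \<in> sets N"
  shows "f \<in> measurable N (borel_on T)"
  unfolding borel_on_def using assms by (intro measurable_measure_of) (auto dest: openin_subset)

text \<open>Measurable choice from countably many candidates: take the first one, in a fixed enumeration of
  \<open>D\<close>, that satisfies the required property.\<close>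

lemma measurable_countable_index:
  fixes N :: "'c measure"
  assumes "countable D" and "\<And>q. q \<in> D \<Longrightarrow> {x \<in> space N. P q x} \<in> sets N"
    and "\<And>x. x \<in> space N \<Longrightarrow> \<exists>q\<in>D. P q x"
  shows "\<exists>h \<in> measurable N (count_space (UNIV :: nat set)).
           \<forall>x \<in> space N. from_nat_into D (h x) \<in> D \<and> P (from_nat_into D (h x)) x"
proof (cases "space N = {}")
  case True
  then show ?thesis by (auto simp: measurable_def)
next
  case False
  then have ne: "D \<noteq> {}" using assms(3) by auto
  define h where "h = (\<lambda>x. LEAST i. P (from_nat_into D i) x)"
  have [measurable]: "Measurable.pred N (\<lambda>x. P (from_nat_into D i) x)" for i
    using assms(2)[OF from_nat_into[OF ne]] by (simp add: pred_def)
  have "h \<in> measurable N (count_space UNIV)"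
    unfolding h_def by (rule measurable_Least) measurable
  moreover have "P (from_nat_into D (h x)) x" if x: "x \<in> space N" for x
  proof -
    obtain q where q: "q \<in> D" "P q x" using assms(3)[OF x] by blast
    then have "P (from_nat_into D (to_nat_on D q)) x" using assms(1) by simp
    then show ?thesis unfolding h_def by (rule LeastI)
  qed
  ultimately show ?thesis using from_nat_into[OF ne] by blast
qed

locale separable_metric = Metric_space M d
  for M :: "'a set" and d :: "'a \<Rightarrow> 'a \<Rightarrow> real" +
  assumes separable: "separable_space mtopology"
begin

abbreviation "B \<equiv> borel_on mtopology"

lemma obtain_countable_dense:
  obtains D where "countable D" "D \<subseteq> M" "\<And>x e. x \<in> M \<Longrightarrow> 0 < e \<Longrightarrow> \<exists>q\<in>D. d q x < e"
proof -
  obtain D where D: "countable D" "D \<subseteq> M" "mtopology closure_of D = M"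
    using separable unfolding separable_space_def by auto
  have "\<exists>q\<in>D. d q x < e" if "x \<in> M" "0 < e" for x e
  proof -
    have "x \<in> mtopology closure_of D" using D(3) that(1) by simp
    then show ?thesis using that by (auto simp: metric_closure_of commute)
  qed
  with D show thesis by (intro that) auto
qed

text \<open>An open subset of the product is the union of the products of balls contained in it whose centres
  lie in a countable dense set and whose radii are \<open>1 / (n + 1)\<close>: countably many measurable
  rectangles. So couplings are measures on a product \<open>\<sigma>\<close>-algebra and Fubini's theorem
  applies to them.\<close>

lemma sets_borel_on_prod: "sets (borel_on (prod_topology mtopology mtopology)) = sets (B \<Otimes>\<^sub>M B)"
proof (rule antisym)
  obtain D where D: "countable D" "D \<subseteq> M" "\<And>x e. x \<in> M \<Longrightarrow> 0 < e \<Longrightarrow> \<exists>q\<in>D. d q x < e"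
    by (rule obtain_countable_dense) blast
  have "W \<in> sets (B \<Otimes>\<^sub>M B)" if W: "openin (prod_topology mtopology mtopology) W" for W
  proof -
    define R where "R = (\<lambda>(q, q', n). mball q (1 / Suc n) \<times> mball q' (1 / Suc n))"
    define J where "J = {j \<in> D \<times> D \<times> (UNIV :: nat set). R j \<subseteq> W}"
    have "W \<subseteq> (\<Union>j\<in>J. R j)"
    proof safe
      fix x y assume xy: "(x, y) \<in> W"
      obtain U V where UV: "openin mtopology U" "openin mtopology V" "x \<in> U" "y \<in> V" "U \<times> V \<subseteq> W"
        using W[unfolded openin_prod_topology_alt, rule_format, OF xy] by metis
      obtain r where r: "r > 0" "mball x r \<subseteq> U"
        using UV(1,3) by (auto simp: openin_mtopology)
      obtain s where s: "s > 0" "mball y s \<subseteq> V"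
        using UV(2,4) by (auto simp: openin_mtopology)
      note rs = r s
      have xyM: "x \<in> M" "y \<in> M" using UV(3,4) openin_subset[OF UV(1)] openin_subset[OF UV(2)] by auto
      obtain n where n: "1 / real (Suc n) < min r s / 2"
        using reals_Archimedean[of "min r s / 2"] rs 
        by (auto simp: inverse_eq_divide simp del: of_nat_Suc)
      then have n: "1 / real (Suc n) < r / 2" "1 / real (Suc n) < s / 2" by linarith+
      obtain q where q: "q \<in> D" "d q x < 1 / Suc n" using D(3)[OF xyM(1), of "1 / Suc n"] by (auto simp del: of_nat_Suc)
      obtain q' where q': "q' \<in> D" "d q' y < 1 / Suc n" using D(3)[OF xyM(2), of "1 / Suc n"] by (auto simp del: of_nat_Suc)
      have "mball q (1 / Suc n) \<subseteq> mball x r"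
        by (rule mball_subset) (use q n xyM in linarith, rule xyM)
      moreover have "mball q' (1 / Suc n) \<subseteq> mball y s"
        by (rule mball_subset) (use q' n xyM in linarith, rule xyM)
      ultimately have "R (q, q', n) \<subseteq> U \<times> V"
        unfolding R_def using rs by (auto simp del: in_mball)
      then have "R (q, q', n) \<subseteq> W" using UV(5) by (rule subset_trans)
      moreover have "(x, y) \<in> R (q, q', n)" using q q' xyM D(2) by (auto simp: R_def)
      ultimately show "(x, y) \<in> (\<Union>j\<in>J. R j)"
        using q(1) q'(1) by (intro UN_I[of "(q, q', n)"]) (simp_all add: J_def)
    qed
    then have "W = (\<Union>j\<in>J. R j)" by (auto simp: J_def)
    moreover have "countable J"
      by (rule countable_subset[of _ "D \<times> D \<times> UNIV"]) (use D(1) in \<open>auto simp: J_def\<close>)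
    moreover have "R j \<in> sets (B \<Otimes>\<^sub>M B)" for j
      by (cases j) (auto simp: R_def openin_sets_borel_on)
    ultimately show ?thesis by (auto intro: sets.countable_UN')
  qed
  then show "sets (borel_on (prod_topology mtopology mtopology)) \<subseteq> sets (B \<Otimes>\<^sub>M B)"
    unfolding sets_borel_on[of "prod_topology mtopology mtopology"]
  proof (intro sets.sigma_sets_subset' subsetI)
    have "space (B \<Otimes>\<^sub>M B) = topspace (prod_topology mtopology mtopology)"
      by (simp add: space_pair_measure)
    then show "topspace (prod_topology mtopology mtopology) \<in> sets (B \<Otimes>\<^sub>M B)"
      using sets.top[of "B \<Otimes>\<^sub>M B"] by simp
  qed simp
  let ?P = "borel_on (prod_topology mtopology mtopology)"
  have "fst \<in> measurable ?P B"
  proof (rule measurable_borel_onI)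
    fix U assume U: "openin mtopology U"
    then have "fst -` U \<inter> space ?P = U \<times> M" using openin_subset[OF U] by auto
    then show "fst -` U \<inter> space ?P \<in> sets ?P"
      using U openin_topspace[of mtopology] by (auto intro!: openin_sets_borel_on simp: openin_prod_Times_iff)
  qed auto
  moreover have "snd \<in> measurable ?P B"
  proof (rule measurable_borel_onI)
    fix U assume U: "openin mtopology U"
    then have "snd -` U \<inter> space ?P = M \<times> U" using openin_subset[OF U] by auto
    then show "snd -` U \<inter> space ?P \<in> sets ?P"
      using U openin_topspace[of mtopology] by (auto intro!: openin_sets_borel_on simp: openin_prod_Times_iff)
  qed auto
  ultimately have "id \<in> measurable ?P (B \<Otimes>\<^sub>M B)"
    by (subst measurable_pair_iff) (simp add: comp_def id_def)
  note id = this
  show "sets (B \<Otimes>\<^sub>M B) \<subseteq> sets ?P"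
  proof
    fix A assume A: "A \<in> sets (B \<Otimes>\<^sub>M B)"
    have "A \<subseteq> space ?P" using sets.sets_into_space[OF A] by (simp add: space_pair_measure)
    then have "id -` A \<inter> space ?P = A" by auto
    then show "A \<in> sets ?P" using measurable_sets[OF id A] by simp
  qed
qed

lemma measurable_dist [measurable]: "(\<lambda>z. d (fst z) (snd z)) \<in> borel_measurable (B \<Otimes>\<^sub>M B)"
proof (rule borel_measurableI_less)
  fix r :: real
  have "openin (prod_topology mtopology mtopology) {z \<in> M \<times> M. d (fst z) (snd z) < r}"
    unfolding openin_prod_topology_alt
  proof (intro allI impI)
    fix x y assume xy: "(x, y) \<in> {z \<in> M \<times> M. d (fst z) (snd z) < r}"
    define e where "e = (r - d x y) / 2"
    have e: "e > 0" using xy by (simp add: e_def)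
    have "d x' y' < r" if "x' \<in> M" "y' \<in> M" "d x x' < e" "d y y' < e" for x' y'
      using that xy triangle[of x' x y'] triangle[of x y y'] commute[of x x']
      by (simp add: e_def field_simps)
    then show "\<exists>U V. openin mtopology U \<and> openin mtopology V \<and> x \<in> U \<and> y \<in> V
        \<and> U \<times> V \<subseteq> {z \<in> M \<times> M. d (fst z) (snd z) < r}"
      using xy e by (intro exI[of _ "mball x e"] exI[of _ "mball y e"]) auto
  qed
  then show "{z \<in> space (B \<Otimes>\<^sub>M B). d (fst z) (snd z) < r} \<in> sets (B \<Otimes>\<^sub>M B)"
    using openin_sets_borel_on[of "prod_topology mtopology mtopology"]
    by (simp add: space_pair_measure sets_borel_on_prod)
qed

text \<open>The cells are the fibres of \<open>h\<close>, which numbers points by a nearby member of a countable dense set.\<close>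

lemma small_countable_partition:
  assumes "e > 0"
  obtains h where "h \<in> measurable B (count_space (UNIV :: nat set))"
    "\<And>x y. x \<in> M \<Longrightarrow> y \<in> M \<Longrightarrow> h x = h y \<Longrightarrow> d x y < e"
proof -
  obtain D where D: "countable D" "D \<subseteq> M" "\<And>x e. x \<in> M \<Longrightarrow> 0 < e \<Longrightarrow> \<exists>q\<in>D. d q x < e"
    by (rule obtain_countable_dense) blast
  have "{x \<in> space B. d q x < e / 2} \<in> sets B" if "q \<in> D" for q
  proof -
    have "{x \<in> space B. d q x < e / 2} = mball q (e / 2)" using that D(2) by auto
    then show ?thesis by (simp add: openin_sets_borel_on)
  qed
  moreover have "\<exists>q\<in>D. d q x < e / 2" if "x \<in> space B" for x
    using D(3)[of x "e / 2"] that assms by auto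
  ultimately obtain h where h: "h \<in> measurable B (count_space UNIV)"
    "\<forall>x\<in>space B. from_nat_into D (h x) \<in> D \<and> d (from_nat_into D (h x)) x < e / 2"
    using measurable_countable_index[OF D(1), of B "\<lambda>q x. d q x < e / 2"] by blast
  have "d x y < e" if "x \<in> M" "y \<in> M" "h x = h y" for x y
  proof -
    let ?q = "from_nat_into D (h x)"
    have "?q \<in> M" "d ?q x < e / 2" "d ?q y < e / 2" using h(2) that D(2) by auto
    then show ?thesis using triangle[of x ?q y] commute[of x ?q] that by simp
  qed
  with h(1) show thesis by (rule that)
qed

end

section \<open>Transport plans and the Wasserstein distance\<close>

text \<open>A plan carries the mass of its marginals, whereas the couplings in the definition of the
  Wasserstein distance are normalised to probability measures. Without the normalisation, cutting
  down a plan yields a plan between smaller measures, and the null measure is a plan as well.\<close>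

definition plan ::
  "'a set \<Rightarrow> ('a \<Rightarrow> 'a \<Rightarrow> real) \<Rightarrow> 'a measure \<Rightarrow> 'a measure \<Rightarrow> ('a \<times> 'a) measure \<Rightarrow> bool" where
  "plan X d \<mu> \<nu> \<pi> \<longleftrightarrow>
     sets \<pi> = sets (borel_on (Metric_space.mtopology X d) \<Otimes>\<^sub>M borel_on (Metric_space.mtopology X d)) \<and>
     distr \<pi> (borel_on (Metric_space.mtopology X d)) fst = \<mu> \<and>
     distr \<pi> (borel_on (Metric_space.mtopology X d)) snd = \<nu>"

text \<open>\<open>A\<close> bounds the \<open>p\<close>-th root of the cost. Arguing with such bounds replaces the infimum in the
  Wasserstein distance by a single plan and combines directly with \<open>Minkowski_powr_bound\<close>.\<close>

definition transport_le ::
  "'a set \<Rightarrow> ('a \<Rightarrow> 'a \<Rightarrow> real) \<Rightarrow> real \<Rightarrow> real \<Rightarrow> 'a measure \<Rightarrow> 'a measure \<Rightarrow> bool" where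
  "transport_le X d p A \<mu> \<nu> \<longleftrightarrow>
     (\<exists>\<pi>. plan X d \<mu> \<nu> \<pi> \<and> (\<integral>\<^sup>+z. ennreal (d (fst z) (snd z) powr p) \<partial>\<pi>) \<le> ennreal (A powr p))"

lemma powr_inverse_cancel:
  fixes A p :: real
  assumes "p \<ge> 1" "A \<ge> 0"
  shows "(A powr p) powr (1 / p) = A"
  using assms by (simp add: powr_powr)

locale bounded_separable_metric = separable_metric M d
  for M :: "'a set" and d :: "'a \<Rightarrow> 'a \<Rightarrow> real" +
  fixes p :: real
  assumes bounded: "mbounded M" and p: "p \<ge> 1"
begin

abbreviation "cost \<pi> \<equiv> (\<integral>\<^sup>+z. ennreal (d (fst z) (snd z) powr p) \<partial>\<pi>)"

lemma obtain_diameter_bound: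
  obtains K where "K > 0" "\<And>x y. x \<in> M \<Longrightarrow> y \<in> M \<Longrightarrow> d x y \<le> K"
  using bounded unfolding mbounded_alt_pos by blast

lemma finite_measuresD:
  assumes "\<mu> \<in> finite_measures M d"
  shows "sets \<mu> = sets B" "space \<mu> = M" "finite_measure \<mu>"
  using assms sets_eq_imp_space_eq[of \<mu> B] by (simp_all add: finite_measures_def)

lemma finite_measuresI: "sets \<mu> = sets B \<Longrightarrow> finite_measure \<mu> \<Longrightarrow> \<mu> \<in> finite_measures M d"
  by (simp add: finite_measures_def)

text \<open>On a bounded space, a finite measure has all moments.\<close>

lemma measures_p_eq: "measures_p M d p = finite_measures M d"
proof -
  obtain K where K: "K > 0" "\<And>x y. x \<in> M \<Longrightarrow> y \<in> M \<Longrightarrow> d x y \<le> K"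
    by (rule obtain_diameter_bound) blast
  have "(\<integral>\<^sup>+x. ennreal (d x x0 powr p) \<partial>\<mu>) < \<infinity>" if "\<mu> \<in> finite_measures M d" "x0 \<in> M" for \<mu> x0
  proof -
    interpret finite_measure \<mu> using finite_measuresD[OF that(1)] by simp
    have "(\<integral>\<^sup>+x. ennreal (d x x0 powr p) \<partial>\<mu>) \<le> (\<integral>\<^sup>+x. ennreal (K powr p) \<partial>\<mu>)"
      using finite_measuresD[OF that(1)] that(2) K p
      by (intro nn_integral_mono) (auto intro!: ennreal_leI powr_mono2)
    also have "\<dots> < \<infinity>" by (simp add: emeasure_eq_measure ennreal_mult[symmetric])
    finally show ?thesis .
  qed
  then show ?thesis unfolding measures_p_def by auto
qed

lemma null_measure_finite_measures: "null_measure B \<in> finite_measures M d"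
  by (intro finite_measuresI) (auto intro!: finite_measureI)

lemma planD:
  assumes "plan M d \<mu> \<nu> \<pi>"
  shows "sets \<pi> = sets (B \<Otimes>\<^sub>M B)" "space \<pi> = M \<times> M" "distr \<pi> B fst = \<mu>" "distr \<pi> B snd = \<nu>"
    and "fst \<in> measurable \<pi> B" "snd \<in> measurable \<pi> B"
  using assms sets_eq_imp_space_eq[of \<pi> "B \<Otimes>\<^sub>M B"]
  by (auto simp: plan_def space_pair_measure cong: measurable_cong_sets)

lemma plan_emeasure:
  assumes "plan M d \<mu> \<nu> \<pi>" "A \<in> sets B"
  shows "emeasure \<mu> A = emeasure \<pi> (A \<times> M)" "emeasure \<nu> A = emeasure \<pi> (M \<times> A)"
proof -
  have "A \<subseteq> M" using sets.sets_into_space[OF assms(2)] by simp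
  then have "fst -` A \<inter> space \<pi> = A \<times> M" "snd -` A \<inter> space \<pi> = M \<times> A"
    using planD(2)[OF assms(1)] by auto
  then show "emeasure \<mu> A = emeasure \<pi> (A \<times> M)" "emeasure \<nu> A = emeasure \<pi> (M \<times> A)"
    using emeasure_distr[OF planD(5)[OF assms(1)] assms(2)]
      emeasure_distr[OF planD(6)[OF assms(1)] assms(2)] planD(3,4)[OF assms(1)] by simp_all
qed

lemma planI:
  assumes "sets \<pi> = sets (B \<Otimes>\<^sub>M B)" "sets \<mu> = sets B" "sets \<nu> = sets B"
    and "\<And>A. A \<in> sets B \<Longrightarrow> emeasure \<pi> (A \<times> M) = emeasure \<mu> A"
    and "\<And>A. A \<in> sets B \<Longrightarrow> emeasure \<pi> (M \<times> A) = emeasure \<nu> A"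
  shows "plan M d \<mu> \<nu> \<pi>"
proof -
  have sp: "space \<pi> = M \<times> M" using sets_eq_imp_space_eq[OF assms(1)] by (simp add: space_pair_measure)
  have m: "fst \<in> measurable \<pi> B" "snd \<in> measurable \<pi> B"
    using assms(1) by (auto cong: measurable_cong_sets)
  have im: "fst -` A \<inter> space \<pi> = A \<times> M" "snd -` A \<inter> space \<pi> = M \<times> A" if "A \<in> sets B" for A
    using sets.sets_into_space[OF that] sp by auto
  show ?thesis unfolding plan_def
  proof (intro conjI)
    show "sets \<pi> = sets (B \<Otimes>\<^sub>M B)" by fact
    show "distr \<pi> B fst = \<mu>"
      by (rule measure_eqI) (use assms in \<open>simp_all add: emeasure_distr[OF m(1)] im\<close>)
    show "distr \<pi> B snd = \<nu>"
      by (rule measure_eqI) (use assms in \<open>simp_all add: emeasure_distr[OF m(2)] im\<close>)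
  qed
qed

lemma plan_marginals:
  assumes "plan M d \<mu> \<nu> \<pi>"
  shows "sets \<mu> = sets B" "sets \<nu> = sets B" "space \<mu> = M" "space \<nu> = M"
    and "emeasure \<pi> (M \<times> M) = emeasure \<mu> M" "emeasure \<pi> (M \<times> M) = emeasure \<nu> M" "mass \<mu> = mass \<nu>"
proof -
  show s: "sets \<mu> = sets B" "sets \<nu> = sets B" using planD[OF assms] by auto
  show sp: "space \<mu> = M" "space \<nu> = M" using planD(3,4)[OF assms] by auto
  have "M \<in> sets B" using sets.top[of B] by simp
  then show e: "emeasure \<pi> (M \<times> M) = emeasure \<mu> M" "emeasure \<pi> (M \<times> M) = emeasure \<nu> M"
    using plan_emeasure[OF assms] by auto
  show "mass \<mu> = mass \<nu>" using sp e by (simp add: mass_def measure_def)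
qed

lemma plan_finite:
  assumes "plan M d \<mu> \<nu> \<pi>" "finite_measure \<mu>"
  shows "finite_measure \<pi>" "finite_measure \<nu>"
proof -
  have "emeasure \<mu> M \<noteq> \<infinity>" using finite_measure.finite_emeasure_space[OF assms(2)] plan_marginals[OF assms(1)] by simp
  then show "finite_measure \<pi>" "finite_measure \<nu>"
    using plan_marginals[OF assms(1)] planD(2)[OF assms(1)] by (auto intro!: finite_measureI)
qed

lemma coupling_of_plan:
  assumes pl: "plan M d \<mu> \<nu> \<pi>" and fin: "finite_measure \<mu>" and m: "mass \<mu> > 0"
  shows "scale_measure (ennreal (1 / mass \<mu>)) \<pi> \<in> couplings M d \<mu> \<nu>"
proof -
  interpret \<mu>: finite_measure \<mu> by fact
  interpret \<pi>: finite_measure \<pi> using plan_finite[OF pl fin] by simp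
  have em: "emeasure \<mu> M = ennreal (mass \<mu>)"
    using plan_marginals(3)[OF pl] by (simp add: mass_def \<mu>.emeasure_eq_measure)
  have "prob_space (scale_measure (ennreal (1 / mass \<mu>)) \<pi>)"
    using m planD(2)[OF pl] em plan_marginals(5)[OF pl]
    by (intro prob_spaceI) (simp add: space_scale_measure ennreal_mult[symmetric])
  moreover have "measure \<pi> (A \<times> M) = measure \<mu> A" "measure \<pi> (M \<times> A) = measure \<nu> A" if "A \<in> sets B" for A
    using plan_emeasure[OF pl that] by (simp_all add: measure_def)
  ultimately show ?thesis
    unfolding couplings_def using planD(1)[OF pl] plan_marginals(7)[OF pl] m
    by (simp add: sets_borel_on_prod)
qed

lemma plan_of_coupling:
  assumes pi: "\<pi> \<in> couplings M d \<mu> \<nu>" and fin: "\<mu> \<in> finite_measures M d" "\<nu> \<in> finite_measures M d"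
    and m: "mass \<mu> = mass \<nu>"
  shows "plan M d \<mu> \<nu> (scale_measure (ennreal (mass \<mu>)) \<pi>)"
proof -
  interpret \<mu>: finite_measure \<mu> using finite_measuresD[OF fin(1)] by simp
  interpret \<nu>: finite_measure \<nu> using finite_measuresD[OF fin(2)] by simp
  interpret \<pi>: prob_space \<pi> using pi by (simp add: couplings_def)
  have m0: "mass \<mu> \<ge> 0" by (simp add: mass_def)
  show ?thesis
  proof (rule planI)
    show "sets (scale_measure (ennreal (mass \<mu>)) \<pi>) = sets (B \<Otimes>\<^sub>M B)"
      using pi by (simp add: couplings_def sets_borel_on_prod)
    fix A assume A: "A \<in> sets B"
    have "mass \<mu> * measure \<pi> (A \<times> M) = measure \<mu> A" "mass \<mu> * measure \<pi> (M \<times> A) = measure \<nu> A"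
      using pi A m by (auto simp: couplings_def)
    then show "emeasure (scale_measure (ennreal (mass \<mu>)) \<pi>) (A \<times> M) = emeasure \<mu> A"
      "emeasure (scale_measure (ennreal (mass \<mu>)) \<pi>) (M \<times> A) = emeasure \<nu> A"
      using m0 by (simp_all add: \<mu>.emeasure_eq_measure \<nu>.emeasure_eq_measure \<pi>.emeasure_eq_measure
          ennreal_mult[symmetric])
  qed (use finite_measuresD[OF fin(1)] finite_measuresD[OF fin(2)] in auto)
qed

lemma cost_scale_measure:
  assumes "sets \<pi> = sets (B \<Otimes>\<^sub>M B)"
  shows "cost (scale_measure r \<pi>) = r * cost \<pi>"
proof -
  note [measurable_cong] = assms
  show ?thesis by (intro nn_integral_scale_measure) measurable
qed

lemma wasserstein_nonneg: "wasserstein M d p \<mu> \<nu> \<ge> 0"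
  by (simp add: wasserstein_def)

lemma wasserstein_le_of_transport:
  assumes "transport_le M d p A \<mu> \<nu>" "finite_measure \<mu>" "A \<ge> 0"
  shows "wasserstein M d p \<mu> \<nu> \<le> A"
proof (cases "mass \<mu> = 0")
  case True then show ?thesis using assms(3) by (simp add: wasserstein_def)
next
  case False
  then have m: "mass \<mu> > 0" by (simp add: mass_def zero_less_measure_iff)
  obtain \<pi> where pl: "plan M d \<mu> \<nu> \<pi>" and c: "cost \<pi> \<le> ennreal (A powr p)"
    using assms(1) by (auto simp: transport_le_def)
  have "(INF \<pi>\<in>couplings M d \<mu> \<nu>. cost \<pi>) \<le> cost (scale_measure (ennreal (1 / mass \<mu>)) \<pi>)"
    by (rule INF_lower[OF coupling_of_plan[OF pl assms(2) m]])
  also have "\<dots> \<le> ennreal (1 / mass \<mu>) * ennreal (A powr p)"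
    unfolding cost_scale_measure[OF planD(1)[OF pl]] by (intro mult_left_mono c) auto
  also have "\<dots> = ennreal (A powr p / mass \<mu>)"
    using m by (simp add: ennreal_mult[symmetric])
  finally have "enn2real (INF \<pi>\<in>couplings M d \<mu> \<nu>. cost \<pi>) \<le> A powr p / mass \<mu>"
    using m by (intro enn2real_leI) auto
  then have "mass \<mu> * enn2real (INF \<pi>\<in>couplings M d \<mu> \<nu>. cost \<pi>) \<le> A powr p"
    using m by (simp add: field_simps)
  then have "wasserstein M d p \<mu> \<nu> \<le> (A powr p) powr (1 / p)"
    unfolding wasserstein_def using m p by (intro powr_mono2) auto
  then show ?thesis using powr_inverse_cancel[OF p assms(3)] by simp
qed

text \<open>The normalised product measure is a coupling, and its cost is finite because the space is bounded.
  Finiteness matters since \<^const>\<open>enn2real\<close> would turn an infinite infimum into \<open>0\<close>.\<close>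

lemma exists_finite_cost_coupling:
  assumes fin: "\<mu> \<in> finite_measures M d" "\<nu> \<in> finite_measures M d"
    and m: "mass \<mu> = mass \<nu>" "mass \<mu> > 0"
  shows "(INF \<pi>\<in>couplings M d \<mu> \<nu>. cost \<pi>) < \<infinity>"
proof -
  note f = finite_measuresD[OF fin(1)] finite_measuresD[OF fin(2)]
  interpret \<mu>: finite_measure \<mu> by (rule f)
  interpret \<nu>: finite_measure \<nu> by (rule f)
  obtain K where K: "K > 0" "\<And>x y. x \<in> M \<Longrightarrow> y \<in> M \<Longrightarrow> d x y \<le> K"
    by (rule obtain_diameter_bound) blast
  define \<pi> where "\<pi> = scale_measure (ennreal (1 / mass \<mu>)) (\<mu> \<Otimes>\<^sub>M \<nu>)"
  have M: "M \<in> sets B" using sets.top[of B] by simp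
  have "plan M d \<mu> \<nu> \<pi>"
  proof (rule planI)
    show "sets \<pi> = sets (B \<Otimes>\<^sub>M B)"
      using f by (auto simp: \<pi>_def intro!: sets_pair_measure_cong)
    fix A assume A: "A \<in> sets B"
    have "emeasure (\<mu> \<Otimes>\<^sub>M \<nu>) (A \<times> M) = ennreal (measure \<mu> A * mass \<mu>)"
      "emeasure (\<mu> \<Otimes>\<^sub>M \<nu>) (M \<times> A) = ennreal (mass \<mu> * measure \<nu> A)"
      using A M f m(1) by (simp_all add: \<nu>.emeasure_pair_measure_Times \<mu>.emeasure_eq_measure
          \<nu>.emeasure_eq_measure ennreal_mult mass_def)
    then show "emeasure \<pi> (A \<times> M) = emeasure \<mu> A" "emeasure \<pi> (M \<times> A) = emeasure \<nu> A"
      using m(2) by (simp_all add: \<pi>_def \<mu>.emeasure_eq_measure \<nu>.emeasure_eq_measure ennreal_mult[symmetric])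
  qed (use f in auto)
  note pl = this
  let ?\<pi>' = "scale_measure (ennreal (1 / mass \<mu>)) \<pi>"
  have c: "?\<pi>' \<in> couplings M d \<mu> \<nu>" by (rule coupling_of_plan[OF pl f(3) m(2)])
  then interpret \<pi>': prob_space ?\<pi>' by (simp add: couplings_def)
  have "(INF \<pi>\<in>couplings M d \<mu> \<nu>. cost \<pi>) \<le> cost ?\<pi>'" by (rule INF_lower[OF c])
  also have "\<dots> \<le> (\<integral>\<^sup>+z. ennreal (K powr p) \<partial>?\<pi>')"
    using planD(2)[OF pl] K p
    by (intro nn_integral_mono) (auto simp: space_scale_measure intro!: ennreal_leI powr_mono2)
  also have "\<dots> = ennreal (K powr p)" using \<pi>'.emeasure_space_1 by simp
  finally show ?thesis by (simp add: le_less_trans)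
qed

lemma transport_of_wasserstein_less:
  assumes fin: "\<mu> \<in> finite_measures M d" "\<nu> \<in> finite_measures M d"
    and m: "mass \<mu> = mass \<nu>" and A: "wasserstein M d p \<mu> \<nu> < A"
  shows "transport_le M d p A \<mu> \<nu>"
proof -
  note f = finite_measuresD[OF fin(1)] finite_measuresD[OF fin(2)]
  interpret \<mu>: finite_measure \<mu> by (rule f)
  interpret \<nu>: finite_measure \<nu> by (rule f)
  show ?thesis
  proof (cases "mass \<mu> = 0")
    case True
    have "emeasure \<mu> E = 0" "emeasure \<nu> E = 0" for E
      using emeasure_space[of \<mu> E] emeasure_space[of \<nu> E] True m
      by (simp_all add: mass_def \<mu>.emeasure_eq_measure \<nu>.emeasure_eq_measure measure_le_0_iff)
    then have "plan M d \<mu> \<nu> (null_measure (B \<Otimes>\<^sub>M B))"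
      using f by (intro planI) auto
    then show ?thesis unfolding transport_le_def by (intro exI conjI) auto
  next
    case False
    then have m0: "mass \<mu> > 0" by (simp add: mass_def zero_less_measure_iff)
    define I where "I = (INF \<pi>\<in>couplings M d \<mu> \<nu>. cost \<pi>)"
    have I: "I < \<infinity>" unfolding I_def by (rule exists_finite_cost_coupling[OF fin m m0])
    have A0: "A > 0" using A wasserstein_nonneg[of \<mu> \<nu>] by linarith
    have "mass \<mu> * enn2real I < A powr p"
    proof (rule ccontr)
      assume "\<not> ?thesis"
      then have "(A powr p) powr (1 / p) \<le> (mass \<mu> * enn2real I) powr (1 / p)"
        using p by (intro powr_mono2) auto
      then show False
        using A powr_inverse_cancel[OF p, of A] A0 by (simp add: wasserstein_def I_def)
    qed
    then have "enn2real I < A powr p / mass \<mu>" using m0 by (simp add: field_simps)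
    then have "I < ennreal (A powr p / mass \<mu>)"
      using I by (metis enn2real_nonneg ennreal_enn2real ennreal_less_iff infinity_ennreal_def)
    then obtain \<pi> where \<pi>: "\<pi> \<in> couplings M d \<mu> \<nu>" "cost \<pi> < ennreal (A powr p / mass \<mu>)"
      unfolding I_def by (auto simp: INF_less_iff)
    have "cost (scale_measure (ennreal (mass \<mu>)) \<pi>) = ennreal (mass \<mu>) * cost \<pi>"
      using \<pi>(1) by (intro cost_scale_measure) (simp add: couplings_def sets_borel_on_prod)
    also have "\<dots> \<le> ennreal (mass \<mu>) * ennreal (A powr p / mass \<mu>)"
      using \<pi>(2) by (intro mult_left_mono) auto
    also have "\<dots> = ennreal (A powr p)" using m0 by (simp add: ennreal_mult[symmetric])
    finally show ?thesis
      unfolding transport_le_def using plan_of_coupling[OF \<pi>(1) fin m] by blast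
  qed
qed

lemma transport_le_refl:
  assumes "\<mu> \<in> finite_measures M d"
  shows "transport_le M d p A \<mu> \<mu>"
proof -
  note f = finite_measuresD[OF assms]
  have [measurable]: "(\<lambda>x. (x, x)) \<in> measurable \<mu> (B \<Otimes>\<^sub>M B)"
    using f(1) by (simp cong: measurable_cong_sets)
  have M: "M \<in> sets B" using sets.top[of B] by simp
  let ?\<pi> = "distr \<mu> (B \<Otimes>\<^sub>M B) (\<lambda>x. (x, x))"
  have "plan M d \<mu> \<mu> ?\<pi>"
  proof (rule planI)
    fix A assume A: "A \<in> sets B"
    have "(\<lambda>x. (x, x)) -` (A \<times> M) \<inter> space \<mu> = A" "(\<lambda>x. (x, x)) -` (M \<times> A) \<inter> space \<mu> = A"
      using sets.sets_into_space[OF A] f by auto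
    then show "emeasure ?\<pi> (A \<times> M) = emeasure \<mu> A" "emeasure ?\<pi> (M \<times> A) = emeasure \<mu> A"
      using A M by (simp_all add: emeasure_distr)
  qed (use f in auto)
  moreover have "cost ?\<pi> = (\<integral>\<^sup>+x. ennreal (d x x powr p) \<partial>\<mu>)"
    by (subst nn_integral_distr) auto
  moreover have "\<dots> = (\<integral>\<^sup>+x. 0 \<partial>\<mu>)"
    using f(2) by (intro nn_integral_cong) auto
  ultimately show ?thesis unfolding transport_le_def by (intro exI[of _ ?\<pi>]) simp
qed

lemma transport_le_commute:
  assumes "transport_le M d p A \<mu> \<nu>"
  shows "transport_le M d p A \<nu> \<mu>"
proof -
  obtain \<pi> where pl: "plan M d \<mu> \<nu> \<pi>" and c: "cost \<pi> \<le> ennreal (A powr p)"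
    using assms by (auto simp: transport_le_def)
  note [measurable_cong] = planD(1)[OF pl]
  let ?\<pi>' = "distr \<pi> (B \<Otimes>\<^sub>M B) (\<lambda>z. (snd z, fst z))"
  have "plan M d \<nu> \<mu> ?\<pi>'"
    unfolding plan_def using planD[OF pl] by (auto simp: distr_distr comp_def)
  moreover have "cost ?\<pi>' = cost \<pi>"
    by (subst nn_integral_distr) (auto simp: commute)
  ultimately show ?thesis using c unfolding transport_le_def by (intro exI[of _ ?\<pi>']) simp
qed

end

section \<open>Gluing transport plans along a countable partition\<close>

lemma nn_integral_countable_valued:
  fixes h :: "'a \<Rightarrow> nat"
  assumes h[measurable]: "h \<in> measurable N (count_space UNIV)"
  shows "(\<integral>\<^sup>+x. c (h x) \<partial>N) = (\<Sum>i. c i * emeasure N (h -` {i} \<inter> space N))"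
proof -
  let ?A = "\<lambda>i. h -` {i} \<inter> space N"
  have [measurable]: "?A i \<in> sets N" for i by (rule measurable_sets[OF h]) simp
  have "(\<integral>\<^sup>+x. c (h x) \<partial>N) = (\<integral>\<^sup>+x. (\<Sum>i. c i * indicator (?A i) x) \<partial>N)"
  proof (rule nn_integral_cong)
    fix x assume "x \<in> space N"
    then have "(\<Sum>i. c i * indicator (?A i) x) = c (h x)"
      by (intro suminf_cmult_indicator) (auto simp: disjoint_family_on_def)
    then show "c (h x) = (\<Sum>i. c i * indicator (?A i) x)" by simp
  qed
  also have "\<dots> = (\<Sum>i. \<integral>\<^sup>+x. c i * indicator (?A i) x \<partial>N)"
    by (intro nn_integral_suminf) measurable
  also have "\<dots> = (\<Sum>i. c i * emeasure N (?A i))"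
    by (intro suminf_cong nn_integral_cmult_indicator) measurable
  finally show ?thesis .
qed

lemma sums_measure_countable_valued:
  fixes h :: "'a \<Rightarrow> nat"
  assumes "finite_measure N" and h: "h \<in> measurable N (count_space UNIV)"
  shows "(\<lambda>i. measure N (h -` {i} \<inter> space N)) sums mass N"
proof -
  interpret finite_measure N by fact
  have "(\<lambda>i. measure N (h -` {i} \<inter> space N)) sums measure N (\<Union>i. h -` {i} \<inter> space N)"
    by (rule finite_measure_UNION) (auto simp: disjoint_family_on_def intro: measurable_sets[OF h])
  moreover have "(\<Union>i. h -` {i} \<inter> space N) = space N" by auto
  ultimately show ?thesis by (simp add: mass_def)
qed

text \<open>The part of the product measure where the indices \<open>g1\<close> and \<open>g2\<close> agree, with weight \<open>w i\<close> on the
  pairs of common index \<open>i\<close>. It is the discrete substitute for a fibre product of two measures.\<close>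

definition match_measure ::
  "(nat \<Rightarrow> real) \<Rightarrow> ('a \<Rightarrow> nat) \<Rightarrow> ('b \<Rightarrow> nat) \<Rightarrow> 'a measure \<Rightarrow> 'b measure \<Rightarrow> ('a \<times> 'b) measure" where
  "match_measure w g1 g2 N1 N2 =
     density (N1 \<Otimes>\<^sub>M N2) (\<lambda>z. if g1 (fst z) = g2 (snd z) then ennreal (w (g1 (fst z))) else 0)"

context
  fixes N1 :: "'a measure" and N2 :: "'b measure" and g1 :: "'a \<Rightarrow> nat" and g2 :: "'b \<Rightarrow> nat"
    and w :: "nat \<Rightarrow> real"
  assumes fin: "finite_measure N1" "finite_measure N2"
    and g1[measurable]: "g1 \<in> measurable N1 (count_space UNIV)"
    and g2[measurable]: "g2 \<in> measurable N2 (count_space UNIV)"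
    and w: "\<And>i. w i \<ge> 0"
begin

lemma measurable_match_density [measurable]:
  "(\<lambda>z. if g1 (fst z) = g2 (snd z) then ennreal (w (g1 (fst z))) else 0)
     \<in> borel_measurable (N1 \<Otimes>\<^sub>M N2)"
proof -
  have "Measurable.pred (N1 \<Otimes>\<^sub>M N2) (\<lambda>z. \<exists>i. g1 (fst z) = i \<and> g2 (snd z) = i)"
    by measurable
  moreover have "(\<exists>i. g1 (fst z) = i \<and> g2 (snd z) = i) \<longleftrightarrow> g1 (fst z) = g2 (snd z)" for z
    by auto
  ultimately have [measurable]: "Measurable.pred (N1 \<Otimes>\<^sub>M N2) (\<lambda>z. g1 (fst z) = g2 (snd z))"
    by simp
  show ?thesis by measurable
qed

lemma AE_match_measure: "AE z in match_measure w g1 g2 N1 N2. g1 (fst z) = g2 (snd z)"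
  unfolding match_measure_def
  by (subst AE_density[OF measurable_match_density], rule AE_I2) (auto split: if_splits)

text \<open>The first marginal of the matched measure: the weight of a point is multiplied by the mass of its
  partners.\<close>

lemma nn_integral_match_measure_fst:
  assumes F[measurable]: "F \<in> borel_measurable N1"
  shows "(\<integral>\<^sup>+z. F (fst z) \<partial>match_measure w g1 g2 N1 N2)
       = (\<integral>\<^sup>+x. F x * ennreal (w (g1 x) * measure N2 (g2 -` {g1 x} \<inter> space N2)) \<partial>N1)"
proof -
  interpret N2: finite_measure N2 by (rule fin)
  let ?k = "\<lambda>z. if g1 (fst z) = g2 (snd z) then ennreal (w (g1 (fst z))) else 0"
  have "(\<integral>\<^sup>+z. F (fst z) \<partial>match_measure w g1 g2 N1 N2)
      = (\<integral>\<^sup>+z. ?k z * F (fst z) \<partial>(N1 \<Otimes>\<^sub>M N2))"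
    unfolding match_measure_def by (rule nn_integral_density) measurable
  also have "\<dots> = (\<integral>\<^sup>+x. \<integral>\<^sup>+y. ?k (x, y) * F x \<partial>N2 \<partial>N1)"
    by (subst N2.nn_integral_fst[symmetric]) auto
  also have "\<dots> = (\<integral>\<^sup>+x. F x * ennreal (w (g1 x) * measure N2 (g2 -` {g1 x} \<inter> space N2)) \<partial>N1)"
  proof (rule nn_integral_cong)
    fix x
    have "(\<integral>\<^sup>+y. ?k (x, y) * F x \<partial>N2)
        = (\<integral>\<^sup>+y. (F x * ennreal (w (g1 x))) * indicator (g2 -` {g1 x} \<inter> space N2) y \<partial>N2)"
      by (intro nn_integral_cong) (auto simp: mult.commute)
    also have "\<dots> = F x * ennreal (w (g1 x)) * emeasure N2 (g2 -` {g1 x} \<inter> space N2)"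
      by (intro nn_integral_cmult_indicator) measurable
    finally show "(\<integral>\<^sup>+y. ?k (x, y) * F x \<partial>N2)
        = F x * ennreal (w (g1 x) * measure N2 (g2 -` {g1 x} \<inter> space N2))"
      using w by (simp add: N2.emeasure_eq_measure ennreal_mult mult.assoc)
  qed
  finally show ?thesis .
qed

lemma nn_integral_match_measure_snd:
  assumes F[measurable]: "F \<in> borel_measurable N2"
  shows "(\<integral>\<^sup>+z. F (snd z) \<partial>match_measure w g1 g2 N1 N2)
       = (\<integral>\<^sup>+y. F y * ennreal (w (g2 y) * measure N1 (g1 -` {g2 y} \<inter> space N1)) \<partial>N2)"
proof -
  interpret N1: finite_measure N1 by (rule fin)
  interpret N2: finite_measure N2 by (rule fin)
  interpret pair_sigma_finite N1 N2 ..
  let ?k = "\<lambda>z. if g1 (fst z) = g2 (snd z) then ennreal (w (g1 (fst z))) else 0"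
  have "(\<integral>\<^sup>+z. F (snd z) \<partial>match_measure w g1 g2 N1 N2)
      = (\<integral>\<^sup>+z. ?k z * F (snd z) \<partial>(N1 \<Otimes>\<^sub>M N2))"
    unfolding match_measure_def by (rule nn_integral_density) measurable
  also have "\<dots> = (\<integral>\<^sup>+y. \<integral>\<^sup>+x. ?k (x, y) * F y \<partial>N1 \<partial>N2)"
    by (subst nn_integral_snd[symmetric]) auto
  also have "\<dots> = (\<integral>\<^sup>+y. F y * ennreal (w (g2 y) * measure N1 (g1 -` {g2 y} \<inter> space N1)) \<partial>N2)"
  proof (rule nn_integral_cong)
    fix y
    have "(\<integral>\<^sup>+x. ?k (x, y) * F y \<partial>N1)
        = (\<integral>\<^sup>+x. (F y * ennreal (w (g2 y))) * indicator (g1 -` {g2 y} \<inter> space N1) x \<partial>N1)"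
      by (intro nn_integral_cong) (auto simp: mult.commute)
    also have "\<dots> = F y * ennreal (w (g2 y)) * emeasure N1 (g1 -` {g2 y} \<inter> space N1)"
      by (intro nn_integral_cmult_indicator) measurable
    finally show "(\<integral>\<^sup>+x. ?k (x, y) * F y \<partial>N1)
        = F y * ennreal (w (g2 y) * measure N1 (g1 -` {g2 y} \<inter> space N1))"
      using w by (simp add: N1.emeasure_eq_measure ennreal_mult mult.assoc)
  qed
  finally show ?thesis .
qed

end

context bounded_separable_metric
begin

text \<open>Joining a plan from \<open>\<mu>\<close> to \<open>\<nu>1\<close> with a plan from \<open>\<nu>2\<close> to \<open>\<eta>\<close>. A pair of journeys
  \<open>x \<rightarrow> y\<close>, \<open>y' \<rightarrow> z\<close> is matched when \<open>y\<close> and \<open>y'\<close> lie in the same cell of a fine partition; then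
  \<open>d x z \<le> d x y + e + d y' z\<close>. The weights make the matched mass of each cell equal to the smaller of
  its two masses under \<open>\<nu>1\<close> and \<open>\<nu>2\<close>. Thus the matched measure is dominated by either plan, its cost
  is controlled by Minkowski's inequality, and the mass lost at both ends adds up to the sum of
  \<open>\<bar>\<nu>1 cell - \<nu>2 cell\<bar>\<close> over the cells.\<close>

lemma glue_transports:
  assumes fin: "\<mu> \<in> finite_measures M d" "\<eta> \<in> finite_measures M d"
    and t1: "transport_le M d p A1 \<mu> \<nu>1" and t2: "transport_le M d p A2 \<nu>2 \<eta>"
    and A: "A1 > 0" "A2 > 0" "E > 0"
  obtains \<mu>' \<eta>' where "\<mu>' \<in> finite_measures M d" "\<eta>' \<in> finite_measures M d"
    "transport_le M d p (A1 + E + A2) \<mu>' \<eta>'"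
    "tv_mass \<mu> \<mu>' + tv_mass \<eta> \<eta>' \<le> tv_mass \<nu>1 \<nu>2"
proof -
  obtain \<pi>1 where pl1: "plan M d \<mu> \<nu>1 \<pi>1" and c1: "cost \<pi>1 \<le> ennreal (A1 powr p)"
    using t1 by (auto simp: transport_le_def)
  obtain \<pi>2 where pl2: "plan M d \<nu>2 \<eta> \<pi>2" and c2: "cost \<pi>2 \<le> ennreal (A2 powr p)"
    using t2 by (auto simp: transport_le_def)
  note f = finite_measuresD[OF fin(1)] finite_measuresD[OF fin(2)]
  have pl2': "finite_measure \<nu>2" "finite_measure \<pi>2"
  proof -
    have "emeasure \<nu>2 (space \<nu>2) = emeasure \<eta> (space \<eta>)" using plan_marginals[OF pl2] by simp
    then show "finite_measure \<nu>2"
      using finite_measure.emeasure_finite[OF f(6)] by (intro finite_measureI) simp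
    then show "finite_measure \<pi>2" using plan_finite[OF pl2] by simp
  qed
  note fm = f(3) f(6) plan_finite[OF pl1 f(3)] pl2'
  interpret \<mu>: finite_measure \<mu> by (rule fm)
  interpret \<eta>: finite_measure \<eta> by (rule fm)
  interpret \<pi>1: finite_measure \<pi>1 by (rule fm)
  interpret \<nu>1: finite_measure \<nu>1 by (rule fm)
  interpret \<pi>2: finite_measure \<pi>2 by (rule fm)
  interpret \<nu>2: finite_measure \<nu>2 by (rule fm)
  note sn = plan_marginals[OF pl1] plan_marginals[OF pl2]
  note [measurable_cong] = planD(1)[OF pl1] planD(1)[OF pl2] sn(1,2) sn(8,9)
  note sp = planD(2)[OF pl1] planD(2)[OF pl2]
  have M: "M \<in> sets B" using sets.top[of B] by simp

  \<comment> \<open>The diameter of the cells: the constant function \<open>e\<close> has \<open>L\<^sup>p\<close> norm at most \<open>E\<close>.\<close>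
  define e where "e = E / (mass \<mu> + 1) powr (1 / p)"
  have m0: "mass \<mu> \<ge> 0" by (simp add: mass_def)
  have e: "e > 0" using A m0 by (simp add: e_def)
  have ep: "e powr p * mass \<mu> \<le> E powr p"
  proof -
    have "e powr p = E powr p / (mass \<mu> + 1)"
      using m0 p by (simp add: e_def powr_divide powr_powr)
    then have "e powr p * (mass \<mu> + 1) = E powr p" using m0 by simp
    moreover have "e powr p \<ge> 0" by simp
    ultimately show ?thesis by (simp only: distrib_left)
  qed
  obtain h where h[measurable]: "h \<in> measurable B (count_space (UNIV :: nat set))"
    and hd: "\<And>x y. x \<in> M \<Longrightarrow> y \<in> M \<Longrightarrow> h x = h y \<Longrightarrow> d x y < e"
    using small_countable_partition[OF e] by blast
  define n1 where "n1 = (\<lambda>i. measure \<nu>1 (h -` {i} \<inter> M))"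
  define n2 where "n2 = (\<lambda>i. measure \<nu>2 (h -` {i} \<inter> M))"
  \<comment> \<open>The unweighted product measure gives the pairs in cell \<open>i\<close> the mass \<open>n1 i * n2 i\<close>. If this
     vanishes, so does the minimum, in accordance with division by zero yielding zero.\<close>
  define w where "w = (\<lambda>i. min (n1 i) (n2 i) / (n1 i * n2 i))"
  have n0: "n1 i \<ge> 0" "n2 i \<ge> 0" for i by (simp_all add: n1_def n2_def)
  have w0: "w i \<ge> 0" for i using n0 by (simp add: w_def)
  have wn1: "w i * n2 i * n1 i = min (n1 i) (n2 i)" for i
    using n0[of i] by (cases "n1 i = 0 \<or> n2 i = 0") (auto simp: w_def)
  have w1: "w i * n2 i \<le> 1" "w i * n1 i \<le> 1" for i
    using n0[of i] by (auto simp: w_def min_def divide_simps)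
  have hset: "h -` {i} \<inter> M \<in> sets B" for i
    using measurable_sets[OF h, of "{i}"] by simp
  have hM1: "measure \<pi>1 ((\<lambda>z. h (snd z)) -` {i} \<inter> space \<pi>1) = n1 i" for i
  proof -
    have "(\<lambda>z. h (snd z)) -` {i} \<inter> space \<pi>1 = M \<times> (h -` {i} \<inter> M)" using sp by auto
    then show ?thesis using plan_emeasure(2)[OF pl1 hset[of i]] by (simp add: n1_def measure_def)
  qed
  have hM2: "measure \<pi>2 ((\<lambda>z. h (fst z)) -` {i} \<inter> space \<pi>2) = n2 i" for i
  proof -
    have "(\<lambda>z. h (fst z)) -` {i} \<inter> space \<pi>2 = (h -` {i} \<inter> M) \<times> M" using sp by auto
    then show ?thesis using plan_emeasure(1)[OF pl2 hset[of i]] by (simp add: n2_def measure_def)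
  qed

  \<comment> \<open>A measure on pairs \<open>((x, y), (y', z))\<close>; \<open>int1\<close> and \<open>int2\<close> describe its marginals on \<open>(x, y)\<close> and
     \<open>(y', z)\<close>, with densities at most \<open>1\<close> with respect to the given plans.\<close>
  define G where "G = match_measure w (\<lambda>z. h (snd z)) (\<lambda>z. h (fst z)) \<pi>1 \<pi>2"
  have [measurable]: "(\<lambda>z. h (snd z)) \<in> measurable \<pi>1 (count_space UNIV)"
    "(\<lambda>z. h (fst z)) \<in> measurable \<pi>2 (count_space UNIV)" by measurable
  have sG[measurable_cong]: "sets G = sets ((B \<Otimes>\<^sub>M B) \<Otimes>\<^sub>M (B \<Otimes>\<^sub>M B))"
    unfolding G_def match_measure_def sets_density
    by (rule sets_pair_measure_cong) (use planD(1)[OF pl1] planD(1)[OF pl2] in auto)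
  have spG: "space G = (M \<times> M) \<times> (M \<times> M)"
    using sets_eq_imp_space_eq[OF sG] by (simp add: space_pair_measure)
  have int1: "(\<integral>\<^sup>+z. F (fst z) \<partial>G) = (\<integral>\<^sup>+x. F x * ennreal (w (h (snd x)) * n2 (h (snd x))) \<partial>\<pi>1)"
    if "F \<in> borel_measurable (B \<Otimes>\<^sub>M B)" for F
    unfolding G_def hM2[symmetric]
    by (rule nn_integral_match_measure_fst) (use that fm w0 in measurable)
  have int2: "(\<integral>\<^sup>+z. F (snd z) \<partial>G) = (\<integral>\<^sup>+y. F y * ennreal (w (h (fst y)) * n1 (h (fst y))) \<partial>\<pi>2)"
    if "F \<in> borel_measurable (B \<Otimes>\<^sub>M B)" for F
    unfolding G_def hM1[symmetric]
    by (rule nn_integral_match_measure_snd) (use that fm w0 in measurable)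
  have le1: "(\<integral>\<^sup>+z. F (fst z) \<partial>G) \<le> (\<integral>\<^sup>+x. F x \<partial>\<pi>1)" if "F \<in> borel_measurable (B \<Otimes>\<^sub>M B)" for F
    unfolding int1[OF that]
  proof (intro nn_integral_mono)
    fix x :: "'a \<times> 'a"
    have "ennreal (w (h (snd x)) * n2 (h (snd x))) \<le> 1" using w1 by simp
    then show "F x * ennreal (w (h (snd x)) * n2 (h (snd x))) \<le> F x"
      using mult_left_mono[of _ 1 "F x"] by simp
  qed
  have le2: "(\<integral>\<^sup>+z. F (snd z) \<partial>G) \<le> (\<integral>\<^sup>+x. F x \<partial>\<pi>2)" if "F \<in> borel_measurable (B \<Otimes>\<^sub>M B)" for F
    unfolding int2[OF that]
  proof (intro nn_integral_mono)
    fix x :: "'a \<times> 'a"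
    have "ennreal (w (h (fst x)) * n1 (h (fst x))) \<le> 1" using w1 by simp
    then show "F x * ennreal (w (h (fst x)) * n1 (h (fst x))) \<le> F x"
      using mult_left_mono[of _ 1 "F x"] by simp
  qed

  define \<gamma> where "\<gamma> = distr G (B \<Otimes>\<^sub>M B) (\<lambda>z. (fst (fst z), snd (snd z)))"
  define \<mu>' where "\<mu>' = distr \<gamma> B fst"
  define \<eta>' where "\<eta>' = distr \<gamma> B snd"
  have pl: "plan M d \<mu>' \<eta>' \<gamma>" by (simp add: plan_def \<mu>'_def \<eta>'_def \<gamma>_def)
  have \<mu>'G: "\<mu>' = distr G B (\<lambda>z. fst (fst z))" and \<eta>'G: "\<eta>' = distr G B (\<lambda>z. snd (snd z))"
    unfolding \<mu>'_def \<eta>'_def \<gamma>_def by (subst distr_distr; simp add: comp_def)+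
  have em1: "emeasure \<mu>' S = (\<integral>\<^sup>+z. indicator S (fst (fst z)) \<partial>G)" if "S \<in> sets B" for S
  proof -
    have "emeasure \<mu>' S = (\<integral>\<^sup>+x. indicator S x \<partial>\<mu>')" using that by (simp add: \<mu>'G)
    also have "\<dots> = (\<integral>\<^sup>+z. indicator S (fst (fst z)) \<partial>G)"
      unfolding \<mu>'G using that by (subst nn_integral_distr) auto
    finally show ?thesis .
  qed
  have em2: "emeasure \<eta>' S = (\<integral>\<^sup>+z. indicator S (snd (snd z)) \<partial>G)" if "S \<in> sets B" for S
  proof -
    have "emeasure \<eta>' S = (\<integral>\<^sup>+x. indicator S x \<partial>\<eta>')" using that by (simp add: \<eta>'G)
    also have "\<dots> = (\<integral>\<^sup>+z. indicator S (snd (snd z)) \<partial>G)"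
      unfolding \<eta>'G using that by (subst nn_integral_distr) auto
    finally show ?thesis .
  qed
  have dom1: "emeasure \<mu>' S \<le> emeasure \<mu> S" if S[measurable]: "S \<in> sets B" for S
  proof -
    have "emeasure \<mu>' S \<le> (\<integral>\<^sup>+x. indicator S (fst x) \<partial>\<pi>1)"
      unfolding em1[OF S] by (rule le1) measurable
    also have "\<dots> = (\<integral>\<^sup>+x. indicator S x \<partial>distr \<pi>1 B fst)"
      by (subst nn_integral_distr) auto
    also have "\<dots> = emeasure \<mu> S" unfolding planD(3)[OF pl1] using S f by simp
    finally show ?thesis .
  qed
  have dom2: "emeasure \<eta>' S \<le> emeasure \<eta> S" if S[measurable]: "S \<in> sets B" for S
  proof -
    have "emeasure \<eta>' S \<le> (\<integral>\<^sup>+x. indicator S (snd x) \<partial>\<pi>2)"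
      unfolding em2[OF S] by (rule le2) measurable
    also have "\<dots> = (\<integral>\<^sup>+x. indicator S x \<partial>distr \<pi>2 B snd)"
      by (subst nn_integral_distr) auto
    also have "\<dots> = emeasure \<eta> S" unfolding planD(4)[OF pl2] using S f by simp
    finally show ?thesis .
  qed
  have sets': "sets \<mu>' = sets B" "sets \<eta>' = sets B" and space': "space \<mu>' = M" "space \<eta>' = M"
    by (simp_all add: \<mu>'_def \<eta>'_def)
  have fm1: "finite_measure \<mu>'"
    using dom1[OF M] \<mu>.emeasure_finite[of M] by (intro finite_measureI) (auto simp: space' top_unique)
  have fm2: "finite_measure \<eta>'"
    using dom2[OF M] \<eta>.emeasure_finite[of M] by (intro finite_measureI) (auto simp: space' top_unique)
  interpret \<mu>': finite_measure \<mu>' by (rule fm1)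
  interpret \<eta>': finite_measure \<eta>' by (rule fm2)

  have ssum: "(\<lambda>i. n1 i) sums mass \<nu>1" "(\<lambda>i. n2 i) sums mass \<nu>2"
    using sums_measure_countable_valued[OF fm(4), of h] sums_measure_countable_valued[OF fm(5), of h]
    by (simp_all add: n1_def n2_def sn)
  have smin: "summable (\<lambda>i. min (n1 i) (n2 i))"
    by (rule summable_comparison_test[OF _ sums_summable[OF ssum(1)]]) (use n0 in auto)
  have mass1: "mass \<mu>' = (\<Sum>i. min (n1 i) (n2 i))"
  proof -
    have "emeasure \<mu>' M = (\<integral>\<^sup>+z. indicator M (fst (fst z)) \<partial>G)" by (rule em1[OF M])
    also have "\<dots> = (\<integral>\<^sup>+x. indicator M (fst x) * ennreal (w (h (snd x)) * n2 (h (snd x))) \<partial>\<pi>1)"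
      by (rule int1) (use M in measurable)
    also have "\<dots> = (\<integral>\<^sup>+x. ennreal (w (h (snd x)) * n2 (h (snd x))) \<partial>\<pi>1)"
      by (rule nn_integral_cong) (auto simp: sp)
    also have "\<dots> = (\<integral>\<^sup>+y. ennreal (w (h y) * n2 (h y)) \<partial>distr \<pi>1 B snd)"
      by (subst nn_integral_distr) auto
    also have "\<dots> = (\<integral>\<^sup>+y. ennreal (w (h y) * n2 (h y)) \<partial>\<nu>1)" by (simp add: planD(4)[OF pl1])
    also have "\<dots> = (\<Sum>i. ennreal (w i * n2 i) * emeasure \<nu>1 (h -` {i} \<inter> space \<nu>1))"
      by (rule nn_integral_countable_valued) measurable
    also have "\<dots> = (\<Sum>i. ennreal (min (n1 i) (n2 i)))"
    proof (rule suminf_cong)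
      fix i
      have "emeasure \<nu>1 (h -` {i} \<inter> space \<nu>1) = ennreal (n1 i)"
        by (simp add: sn n1_def \<nu>1.emeasure_eq_measure)
      then show "ennreal (w i * n2 i) * emeasure \<nu>1 (h -` {i} \<inter> space \<nu>1) = ennreal (min (n1 i) (n2 i))"
        using w0 n0 by (simp add: ennreal_mult[symmetric] wn1)
    qed
    also have "\<dots> = ennreal (\<Sum>i. min (n1 i) (n2 i))"
      by (rule suminf_ennreal2) (use n0 smin in auto)
    finally show ?thesis
      using suminf_nonneg[OF smin] n0 by (simp add: mass_def space' \<mu>'.emeasure_eq_measure)
  qed
  \<comment> \<open>Domination turns total variation into loss of mass; the two losses sum up to
     \<open>\<Sum>i. n1 i + n2 i - 2 * min (n1 i) (n2 i)\<close>.\<close>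
  have "mass \<eta>' = mass \<mu>'" using plan_marginals(7)[OF pl] by simp
  moreover have "tv_mass \<mu> \<mu>' \<le> mass \<mu> - mass \<mu>'"
  proof (rule tv_mass_dominated[OF fm(1) fm1])
    fix S assume "S \<in> sets \<mu>"
    then show "measure \<mu>' S \<le> measure \<mu> S"
      using dom1[of S] f by (simp add: \<mu>.emeasure_eq_measure \<mu>'.emeasure_eq_measure)
  qed (simp add: f sets')
  moreover have "tv_mass \<eta> \<eta>' \<le> mass \<eta> - mass \<eta>'"
  proof (rule tv_mass_dominated[OF fm(2) fm2])
    fix S assume "S \<in> sets \<eta>"
    then show "measure \<eta>' S \<le> measure \<eta> S"
      using dom2[of S] f by (simp add: \<eta>.emeasure_eq_measure \<eta>'.emeasure_eq_measure)
  qed (simp add: f sets')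
  moreover have "(\<lambda>i. \<bar>n1 i - n2 i\<bar>) sums (mass \<nu>1 + mass \<nu>2 - 2 * mass \<mu>')"
  proof -
    have "(\<lambda>i. n1 i + n2 i - 2 * min (n1 i) (n2 i)) sums (mass \<nu>1 + mass \<nu>2 - 2 * mass \<mu>')"
      unfolding mass1 by (intro sums_diff sums_add ssum sums_mult summable_sums smin)
    moreover have "n1 i + n2 i - 2 * min (n1 i) (n2 i) = \<bar>n1 i - n2 i\<bar>" for i by (simp add: min_def)
    ultimately show ?thesis by simp
  qed
  moreover have "(\<Sum>i. \<bar>n1 i - n2 i\<bar>) \<le> tv_mass \<nu>1 \<nu>2" if "summable (\<lambda>i. \<bar>n1 i - n2 i\<bar>)"
  proof (rule suminf_le_const[OF that])
    fix n
    show "(\<Sum>i<n. \<bar>n1 i - n2 i\<bar>) \<le> tv_mass \<nu>1 \<nu>2"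
      unfolding n1_def n2_def
      by (rule disjoint_family_sum_le_tv_mass[OF fm(4,5)])
         (use hset sn in \<open>auto simp: disjoint_family_on_def\<close>)
  qed
  ultimately have tv: "tv_mass \<mu> \<mu>' + tv_mass \<eta> \<eta>' \<le> tv_mass \<nu>1 \<nu>2"
    using sn(7) sn(14) sums_unique sums_summable by fastforce

  have "cost \<gamma> = (\<integral>\<^sup>+z. ennreal (d (fst (fst z)) (snd (snd z)) powr p) \<partial>G)"
    unfolding \<gamma>_def by (subst nn_integral_distr) auto
  also have "\<dots> \<le> (\<integral>\<^sup>+z. ennreal ((d (fst (fst z)) (snd (fst z)) + e + d (fst (snd z)) (snd (snd z))) powr p) \<partial>G)"
  proof (rule nn_integral_mono_AE)
    have "AE z in G. h (snd (fst z)) = h (fst (snd z))"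
      unfolding G_def by (rule AE_match_measure) (use fm w0 in measurable)
    then show "AE z in G. ennreal (d (fst (fst z)) (snd (snd z)) powr p)
        \<le> ennreal ((d (fst (fst z)) (snd (fst z)) + e + d (fst (snd z)) (snd (snd z))) powr p)"
      using AE_space
    proof eventually_elim
      case (elim z)
      obtain x y y' x' where z: "z = ((x, y), (y', x'))" by (metis prod.collapse)
      have "x \<in> M" "y \<in> M" "y' \<in> M" "x' \<in> M" using elim z by (auto simp: spG)
      then have "d x x' \<le> d x y + e + d y' x'"
        using triangle[of x y x'] triangle[of y y' x'] hd[of y y'] elim(1) z by simp
      then show ?case using p by (auto simp: z intro!: ennreal_leI powr_mono2)
    qed
  qed
  also have "\<dots> \<le> ennreal ((A1 + E + A2) powr p)"
  proof (intro Minkowski_powr_bound)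
    show "(\<integral>\<^sup>+z. ennreal (d (fst (fst z)) (snd (fst z)) powr p) \<partial>G) \<le> ennreal (A1 powr p)"
      by (rule order_trans[OF le1[of "\<lambda>z. ennreal (d (fst z) (snd z) powr p)"] c1]) measurable
    show "(\<integral>\<^sup>+z. ennreal (d (fst (snd z)) (snd (snd z)) powr p) \<partial>G) \<le> ennreal (A2 powr p)"
      by (rule order_trans[OF le2[of "\<lambda>z. ennreal (d (fst z) (snd z) powr p)"] c2]) measurable
    have "emeasure G (space G) \<le> ennreal (mass \<mu>)"
    proof -
      have "emeasure G (space G) = emeasure \<mu>' M"
        unfolding \<mu>'G using M by (subst emeasure_distr) (auto intro!: arg_cong[where f="emeasure G"] simp: spG)
      then show ?thesis using dom1[OF M] f by (simp add: mass_def \<mu>.emeasure_eq_measure)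
    qed
    then have "ennreal (e powr p) * emeasure G (space G) \<le> ennreal (e powr p) * ennreal (mass \<mu>)"
      by (intro mult_left_mono) auto
    also have "\<dots> \<le> ennreal (E powr p)" using ep m0 by (simp add: ennreal_mult[symmetric])
    finally show "(\<integral>\<^sup>+z. ennreal (e powr p) \<partial>G) \<le> ennreal (E powr p)" by simp
  qed (use A e p in \<open>auto simp: intro!: add_nonneg_nonneg\<close>)
  finally have "transport_le M d p (A1 + E + A2) \<mu>' \<eta>'"
    using pl by (auto simp: transport_le_def)
  with tv fm1 fm2 sets' show thesis by (intro that) (auto intro: finite_measuresI)
qed

end

section \<open>The generalized Wasserstein distance is a metric\<close>

locale gen_wasserstein_space = bounded_separable_metric M d p
  for M :: "'a set" and d :: "'a \<Rightarrow> 'a \<Rightarrow> real" and p :: real +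
  fixes a b :: real
  assumes a: "a > 0" and b: "b > 0"
begin

abbreviation "W \<equiv> gen_wasserstein M d p a b"
abbreviation "\<M> \<equiv> finite_measures M d"

lemma tv_nonneg: "\<mu> \<in> \<M> \<Longrightarrow> \<nu> \<in> \<M> \<Longrightarrow> 0 \<le> tv_mass \<mu> \<nu>"
  by (rule tv_mass_nonneg) (simp_all add: finite_measuresD)

lemma tv_triangle:
  "\<mu> \<in> \<M> \<Longrightarrow> \<nu> \<in> \<M> \<Longrightarrow> \<eta> \<in> \<M> \<Longrightarrow> tv_mass \<mu> \<eta> \<le> tv_mass \<mu> \<nu> + tv_mass \<nu> \<eta>"
  by (rule tv_mass_triangle) (simp_all add: finite_measuresD)

lemma transport_le_mass_eq: "transport_le M d p A \<mu> \<nu> \<Longrightarrow> mass \<mu> = mass \<nu>"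
  unfolding transport_le_def by (blast dest: plan_marginals(7))

abbreviation "W_costs \<mu> \<nu> \<equiv>
  {a * tv_mass \<mu> \<mu>' + a * tv_mass \<nu> \<nu>' + b * wasserstein M d p \<mu>' \<nu>' | \<mu>' \<nu>'.
     \<mu>' \<in> \<M> \<and> \<nu>' \<in> \<M> \<and> mass \<mu>' = mass \<nu>'}"

lemma W_costs_nonempty: "W_costs \<mu> \<nu> \<noteq> {}"
proof -
  let ?o = "null_measure B"
  have "a * tv_mass \<mu> ?o + a * tv_mass \<nu> ?o + b * wasserstein M d p ?o ?o \<in> W_costs \<mu> \<nu>"
    using null_measure_finite_measures by (intro CollectI exI[of _ ?o]) simp
  then show ?thesis by (metis empty_iff)
qed

lemma W_lower_bound:
  assumes "\<mu> \<in> \<M>" "\<nu> \<in> \<M>" "\<mu>' \<in> \<M>" "\<nu>' \<in> \<M>"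
  shows "0 \<le> a * tv_mass \<mu> \<mu>' + a * tv_mass \<nu> \<nu>' + b * wasserstein M d p \<mu>' \<nu>'"
  using a b tv_nonneg[OF assms(1,3)] tv_nonneg[OF assms(2,4)] wasserstein_nonneg[of \<mu>' \<nu>'] by simp

text \<open>This lemma and \<open>W_lessE\<close> are the two halves of a description of the distance by
  plans; they replace its definition from here on.\<close>

lemma W_le_of_transport:
  assumes "\<mu> \<in> \<M>" "\<nu> \<in> \<M>" "\<mu>' \<in> \<M>" "\<nu>' \<in> \<M>"
    and t: "transport_le M d p A \<mu>' \<nu>'" "A \<ge> 0"
  shows "W \<mu> \<nu> \<le> a * tv_mass \<mu> \<mu>' + a * tv_mass \<nu> \<nu>' + b * A"
proof -
  have "W \<mu> \<nu> \<le> a * tv_mass \<mu> \<mu>' + a * tv_mass \<nu> \<nu>' + b * wasserstein M d p \<mu>' \<nu>'"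
    unfolding gen_wasserstein_def measures_p_eq
  proof (rule cInf_lower)
    show "bdd_below (W_costs \<mu> \<nu>)"
      using W_lower_bound[OF assms(1,2)] by (intro bdd_belowI[of _ 0]) auto
    show "a * tv_mass \<mu> \<mu>' + a * tv_mass \<nu> \<nu>' + b * wasserstein M d p \<mu>' \<nu>'
      \<in> W_costs \<mu> \<nu>"
      using assms(3,4) transport_le_mass_eq[OF t(1)] by (intro CollectI exI[of _ \<mu>'] exI[of _ \<nu>']) simp
  qed
  also have "\<dots> \<le> a * tv_mass \<mu> \<mu>' + a * tv_mass \<nu> \<nu>' + b * A"
    using wasserstein_le_of_transport[OF t(1) _ t(2)] assms b by (simp add: finite_measuresD)
  finally show ?thesis .
qed

lemma W_lessE:
  assumes "\<mu> \<in> \<M>" "\<nu> \<in> \<M>" "W \<mu> \<nu> < c"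
  obtains \<mu>' \<nu>' A where "\<mu>' \<in> \<M>" "\<nu>' \<in> \<M>" "transport_le M d p A \<mu>' \<nu>'" "A > 0"
    "a * tv_mass \<mu> \<mu>' + a * tv_mass \<nu> \<nu>' + b * A < c"
proof -
  let ?S = "W_costs \<mu> \<nu>"
  note W_costs_nonempty[of \<mu> \<nu>]
  moreover have "Inf ?S < c" using assms(3) by (simp add: gen_wasserstein_def measures_p_eq)
  ultimately obtain s where "s \<in> ?S" "s < c" using cInf_lessD[of ?S c] by blast
  then obtain \<mu>' \<nu>' where m: "\<mu>' \<in> \<M>" "\<nu>' \<in> \<M>" "mass \<mu>' = mass \<nu>'"
    "a * tv_mass \<mu> \<mu>' + a * tv_mass \<nu> \<nu>' + b * wasserstein M d p \<mu>' \<nu>' < c"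
    by (elim CollectE exE conjE) (rule that; simp)
  define t where "t = a * tv_mass \<mu> \<mu>' + a * tv_mass \<nu> \<nu>'"
  have "wasserstein M d p \<mu>' \<nu>' < (c - t) / b"
    using m(4) b by (simp add: t_def pos_less_divide_eq mult.commute)
  then obtain A where A: "wasserstein M d p \<mu>' \<nu>' < A" "A < (c - t) / b" using dense by blast
  have "A > 0" using A(1) wasserstein_nonneg[of \<mu>' \<nu>'] by linarith
  moreover have "t + b * A < c" using A(2) b by (simp add: pos_less_divide_eq mult.commute)
  ultimately show thesis
    using transport_of_wasserstein_less[OF m(1,2,3) A(1)] m(1,2) by (intro that) (auto simp: t_def)
qed

lemma W_nonneg:
  assumes "\<mu> \<in> \<M>" "\<nu> \<in> \<M>"
  shows "0 \<le> W \<mu> \<nu>"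
  unfolding gen_wasserstein_def measures_p_eq
proof (rule cInf_greatest)
  show "W_costs \<mu> \<nu> \<noteq> {}" by (rule W_costs_nonempty)
  show "0 \<le> s" if "s \<in> W_costs \<mu> \<nu>" for s
    using that W_lower_bound[OF assms] by (elim CollectE exE conjE) simp
qed

lemma W_commute_le:
  assumes "\<mu> \<in> \<M>" "\<nu> \<in> \<M>"
  shows "W \<mu> \<nu> \<le> W \<nu> \<mu>"
proof (rule dense_ge)
  fix c assume "W \<nu> \<mu> < c"
  then obtain \<nu>' \<mu>' A where h: "\<nu>' \<in> \<M>" "\<mu>' \<in> \<M>" "transport_le M d p A \<nu>' \<mu>'" "A > 0"
    "a * tv_mass \<nu> \<nu>' + a * tv_mass \<mu> \<mu>' + b * A < c"
    using W_lessE[OF assms(2,1)] by blast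
  then show "W \<mu> \<nu> \<le> c"
    using W_le_of_transport[OF assms h(2,1) transport_le_commute[OF h(3)]] by simp
qed

lemma W_commute: "\<mu> \<in> \<M> \<Longrightarrow> \<nu> \<in> \<M> \<Longrightarrow> W \<mu> \<nu> = W \<nu> \<mu>"
  using W_commute_le by (meson antisym)

lemma W_refl: "\<mu> \<in> \<M> \<Longrightarrow> W \<mu> \<mu> = 0"
  using W_le_of_transport[of \<mu> \<mu> \<mu> \<mu> 0] transport_le_refl[of \<mu> 0] W_nonneg[of \<mu> \<mu>] by simp

text \<open>After gluing, the extra total variation is at most that of \<open>\<nu>1\<close> and \<open>\<nu>2\<close>, hence
  at most the sum of their distances to \<open>\<nu>\<close>, both of which occur on the right-hand side.\<close>

lemma W_triangle:
  assumes "\<mu> \<in> \<M>" "\<nu> \<in> \<M>" "\<eta> \<in> \<M>"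
  shows "W \<mu> \<eta> \<le> W \<mu> \<nu> + W \<nu> \<eta>"
proof (rule field_le_epsilon)
  fix e :: real assume e: "e > 0"
  obtain \<mu>1 \<nu>1 A1 where 1: "\<mu>1 \<in> \<M>" "\<nu>1 \<in> \<M>" "transport_le M d p A1 \<mu>1 \<nu>1" "A1 > 0"
    "a * tv_mass \<mu> \<mu>1 + a * tv_mass \<nu> \<nu>1 + b * A1 < W \<mu> \<nu> + e / 3"
    using W_lessE[of \<mu> \<nu> "W \<mu> \<nu> + e / 3"] assms e by auto
  obtain \<nu>2 \<eta>2 A2 where 2: "\<nu>2 \<in> \<M>" "\<eta>2 \<in> \<M>" "transport_le M d p A2 \<nu>2 \<eta>2" "A2 > 0"
    "a * tv_mass \<nu> \<nu>2 + a * tv_mass \<eta> \<eta>2 + b * A2 < W \<nu> \<eta> + e / 3"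
    using W_lessE[of \<nu> \<eta> "W \<nu> \<eta> + e / 3"] assms e by auto
  obtain \<mu>' \<eta>' where g: "\<mu>' \<in> \<M>" "\<eta>' \<in> \<M>" "transport_le M d p (A1 + e / (3 * b) + A2) \<mu>' \<eta>'"
    "tv_mass \<mu>1 \<mu>' + tv_mass \<eta>2 \<eta>' \<le> tv_mass \<nu>1 \<nu>2"
    using glue_transports[OF 1(1) 2(2) 1(3) 2(3) 1(4) 2(4), of "e / (3 * b)"] e b by auto
  have tv_comm: "tv_mass \<nu>1 \<nu> = tv_mass \<nu> \<nu>1"
  proof -
    have "sets \<nu>1 = sets \<nu>" using finite_measuresD(1) 1(2) assms(2) by simp
    then have "partitions \<nu>1 = partitions \<nu>"
      using sets_eq_imp_space_eq[of \<nu>1 \<nu>] by (simp add: partitions_def)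
    then show ?thesis by (simp add: tv_mass_alt abs_minus_commute)
  qed
  have "tv_mass \<mu> \<mu>' + tv_mass \<eta> \<eta>'
      \<le> tv_mass \<mu> \<mu>1 + tv_mass \<eta> \<eta>2 + (tv_mass \<nu> \<nu>1 + tv_mass \<nu> \<nu>2)"
    using tv_triangle[OF assms(1) 1(1) g(1)] tv_triangle[OF assms(3) 2(2) g(2)]
      tv_triangle[OF 1(2) assms(2) 2(1)] g(4) tv_comm by linarith
  then have "a * (tv_mass \<mu> \<mu>' + tv_mass \<eta> \<eta>')
      \<le> a * (tv_mass \<mu> \<mu>1 + tv_mass \<eta> \<eta>2 + (tv_mass \<nu> \<nu>1 + tv_mass \<nu> \<nu>2))"
    using a by (intro mult_left_mono) auto
  moreover have "W \<mu> \<eta> \<le> a * tv_mass \<mu> \<mu>' + a * tv_mass \<eta> \<eta>' + b * (A1 + e / (3 * b) + A2)"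
    using 1(4) 2(4) e b by (intro W_le_of_transport assms g) auto
  moreover have "b * (A1 + e / (3 * b) + A2) = b * A1 + e / 3 + b * A2"
    using b by (simp add: distrib_left)
  ultimately show "W \<mu> \<eta> \<le> W \<mu> \<nu> + W \<nu> \<eta> + e"
    using 1(5) 2(5) by (simp add: distrib_left)
qed

text \<open>Mass that arrives in \<open>F\<close> either starts within distance \<open>r\<close> of \<open>F\<close> or travels at least \<open>r\<close>; Markov's
  inequality bounds the latter.\<close>

lemma transport_measure_le_nbhd:
  assumes t: "transport_le M d p A \<mu> \<nu>" and fin: "\<mu> \<in> \<M>" "\<nu> \<in> \<M>" and A: "A \<ge> 0" and r: "r > 0"
    and F: "F \<in> sets B"
  shows "measure \<nu> F \<le> measure \<mu> (nbhd M d r F) + (A / r) powr p"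
proof -
  obtain \<pi> where pl: "plan M d \<mu> \<nu> \<pi>" and c: "cost \<pi> \<le> ennreal (A powr p)"
    using t by (auto simp: transport_le_def)
  interpret \<mu>: finite_measure \<mu> using fin by (simp add: finite_measuresD)
  interpret \<nu>: finite_measure \<nu> using fin by (simp add: finite_measuresD)
  interpret \<pi>: finite_measure \<pi> by (rule plan_finite[OF pl]) unfold_locales
  note [measurable_cong] = planD(1)[OF pl]
  let ?U = "nbhd M d r F"
  have U: "?U \<in> sets B"
    unfolding nbhd_def by (intro openin_sets_borel_on openin_Union) auto
  have M: "M \<in> sets B" using sets.top[of B] by simp
  have FM: "F \<subseteq> M" using sets.sets_into_space[OF F] by simp
  define Q where "Q = {z \<in> space \<pi>. r powr p \<le> d (fst z) (snd z) powr p}"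
  have Q[measurable]: "Q \<in> sets \<pi>" unfolding Q_def by measurable
  have UM: "?U \<times> M \<in> sets \<pi>" using planD(1)[OF pl] U M by auto
  have "M \<times> F \<subseteq> ?U \<times> M \<union> Q"
  proof safe
    fix x y assume xy: "x \<in> M" "y \<in> F" "(x, y) \<notin> Q"
    then have "\<not> r \<le> d x y"
      using FM p r planD(2)[OF pl] by (auto simp: Q_def intro: powr_mono2)
    then show "x \<in> ?U" using xy FM by (auto simp: nbhd_def commute intro!: bexI[of _ y])
  qed (use FM in auto)
  then have "measure \<pi> (M \<times> F) \<le> measure \<pi> (?U \<times> M \<union> Q)"
    by (intro \<pi>.finite_measure_mono) (use UM Q in auto)
  also have "\<dots> \<le> measure \<pi> (?U \<times> M) + measure \<pi> Q"
    by (intro measure_Un_le UM Q)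
  finally have "measure \<nu> F \<le> measure \<mu> ?U + measure \<pi> Q"
    using plan_emeasure[OF pl U] plan_emeasure[OF pl F] by (simp add: measure_def)
  moreover have "measure \<pi> Q \<le> (A / r) powr p"
  proof -
    have "ennreal (r powr p) * emeasure \<pi> Q = (\<integral>\<^sup>+z. ennreal (r powr p) * indicator Q z \<partial>\<pi>)"
      using Q by (simp only: nn_integral_cmult_indicator)
    also have "\<dots> \<le> cost \<pi>"
      by (intro nn_integral_mono) (auto simp: Q_def indicator_def intro!: ennreal_leI)
    also have "\<dots> \<le> ennreal (A powr p)" by (rule c)
    finally have "r powr p * measure \<pi> Q \<le> A powr p"
      by (simp add: \<pi>.emeasure_eq_measure ennreal_mult[symmetric])
    then show ?thesis using r A by (simp add: powr_divide field_simps)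
  qed
  ultimately show ?thesis by linarith
qed

text \<open>Competitors of arbitrarily small cost show that \<open>\<nu> F\<close> is at most the \<open>\<mu>\<close>-measure of every
  neighbourhood of \<open>F\<close>; the neighbourhoods of radius \<open>1 / (n + 1)\<close> shrink to \<open>F\<close> as it is closed.\<close>

lemma W_zero_measure_closed_le:
  assumes fin: "\<mu> \<in> \<M>" "\<nu> \<in> \<M>" and W0: "W \<mu> \<nu> = 0" and F: "closedin mtopology F"
  shows "measure \<nu> F \<le> measure \<mu> F"
proof -
  interpret \<mu>: finite_measure \<mu> using fin by (simp add: finite_measuresD)
  interpret \<nu>: finite_measure \<nu> using fin by (simp add: finite_measuresD)
  have FB: "F \<in> sets B" using F by (rule closedin_sets_borel_on)
  have FM: "F \<subseteq> M" using sets.sets_into_space[OF FB] by simp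
  let ?U = "\<lambda>r. nbhd M d r F"
  have U: "?U r \<in> sets B" for r
    unfolding nbhd_def by (intro openin_sets_borel_on openin_Union) auto
  have step: "measure \<nu> F \<le> measure \<mu> (?U r)" if r: "r > 0" for r
  proof (rule field_le_epsilon)
    fix e :: real assume e: "e > 0"
    define s where "s = min (e / 3) 1"
    have s: "0 < s" "s \<le> e / 3" "s \<le> 1" using e by (auto simp: s_def)
    \<comment> \<open>A competitor of cost below \<open>c\<close> changes each measure by at most \<open>s\<close> and has \<open>A / r \<le> s\<close>;
       then \<open>(A / r) powr p \<le> s\<close> because \<open>s \<le> 1\<close> and \<open>p \<ge> 1\<close>.\<close>
    define c where "c = min (a * s) (b * r * s)"
    have c: "c > 0" using a b r s by (simp add: c_def)
    obtain \<mu>' \<nu>' A where h: "\<mu>' \<in> \<M>" "\<nu>' \<in> \<M>" "transport_le M d p A \<mu>' \<nu>'" "A > 0"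
      "a * tv_mass \<mu> \<mu>' + a * tv_mass \<nu> \<nu>' + b * A < c"
      using W_lessE[OF fin, of c] W0 c by auto
    have nn: "0 \<le> a * tv_mass \<mu> \<mu>'" "0 \<le> a * tv_mass \<nu> \<nu>'" "0 \<le> b * A"
      using a b h(4) tv_nonneg[OF fin(1) h(1)] tv_nonneg[OF fin(2) h(2)] by simp_all
    have "a * tv_mass \<mu> \<mu>' \<le> a * s" "a * tv_mass \<nu> \<nu>' \<le> a * s" "b * A \<le> b * (r * s)"
      using nn h(5) by (simp_all add: c_def)
    then have tv: "tv_mass \<mu> \<mu>' \<le> s" "tv_mass \<nu> \<nu>' \<le> s" and As: "A / r \<le> s"
      using a b r by (simp_all add: field_simps)
    have "(A / r) powr p \<le> s powr p" using As h(4) r p by (intro powr_mono2) auto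
    also have "\<dots> \<le> s powr 1" using s p by (intro powr_mono') auto
    finally have Ap: "(A / r) powr p \<le> s" using s by simp
    have "\<bar>measure \<nu> F - measure \<nu>' F\<bar> \<le> tv_mass \<nu> \<nu>'"
      by (rule measure_diff_le_tv_mass) (use fin h FB in \<open>simp_all add: finite_measuresD\<close>)
    moreover have "\<bar>measure \<mu> (?U r) - measure \<mu>' (?U r)\<bar> \<le> tv_mass \<mu> \<mu>'"
      by (rule measure_diff_le_tv_mass) (use fin h U in \<open>simp_all add: finite_measuresD\<close>)
    moreover have "measure \<nu>' F \<le> measure \<mu>' (?U r) + (A / r) powr p"
      by (rule transport_measure_le_nbhd[OF h(3,1,2) _ r FB]) (use h in simp)
    ultimately show "measure \<nu> F \<le> measure \<mu> (?U r) + e" using tv Ap s by linarith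
  qed
  let ?V = "\<lambda>n::nat. ?U (1 / Suc n)"
  have "(\<Inter>n. ?V n) = F"
  proof
    show "F \<subseteq> (\<Inter>n. ?V n)" using FM by (fastforce simp: nbhd_def)
    show "(\<Inter>n. ?V n) \<subseteq> F"
    proof
      fix x assume x: "x \<in> (\<Inter>n. ?V n)"
      then have xM: "x \<in> M" by (auto simp: nbhd_def)
      have "x \<in> mtopology closure_of F"
        unfolding metric_closure_of
      proof (intro CollectI conjI allI impI xM)
        fix e :: real assume "e > 0"
        then obtain n where n: "1 / real (Suc n) < e"
          using reals_Archimedean by (auto simp: inverse_eq_divide simp del: of_nat_Suc)
        obtain y where "y \<in> F" "d y x < 1 / real (Suc n)"
          using x by (auto simp: nbhd_def simp del: of_nat_Suc)
        then show "\<exists>y\<in>F. y \<in> mball x e" using n xM FM commute[of x y] by (intro bexI[of _ y]) auto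
      qed
      then show "x \<in> F" using F by (simp add: closure_of_closedin)
    qed
  qed
  moreover have "(\<lambda>n. measure \<mu> (?V n)) \<longlonglongrightarrow> measure \<mu> (\<Inter>n. ?V n)"
  proof (rule \<mu>.finite_Lim_measure_decseq)
    show "range ?V \<subseteq> sets \<mu>" using U fin by (auto simp: finite_measuresD)
    show "decseq ?V"
    proof (rule decseq_SucI)
      fix n
      have "1 / real (Suc (Suc n)) \<le> 1 / real (Suc n)" by (simp add: field_simps)
      then show "?V (Suc n) \<subseteq> ?V n" unfolding nbhd_def by (intro UN_mono mball_subset_concentric) auto
    qed
  qed
  ultimately show ?thesis
    using step by (intro LIMSEQ_le_const[of "\<lambda>n. measure \<mu> (?V n)"]) (auto simp del: of_nat_Suc)
qed

lemma W_zero_imp_eq: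
  assumes fin: "\<mu> \<in> \<M>" "\<nu> \<in> \<M>" and W0: "W \<mu> \<nu> = 0"
  shows "\<mu> = \<nu>"
proof -
  interpret \<mu>: finite_measure \<mu> using fin by (simp add: finite_measuresD)
  interpret \<nu>: finite_measure \<nu> using fin by (simp add: finite_measuresD)
  note f = finite_measuresD[OF fin(1)] finite_measuresD[OF fin(2)]
  have "W \<nu> \<mu> = 0" using W0 W_commute[OF fin] by simp
  then have closed: "measure \<mu> F = measure \<nu> F" if "closedin mtopology F" for F
    using W_zero_measure_closed_le[OF fin W0 that] W_zero_measure_closed_le[OF fin(2,1) _ that] by simp
  have sc: "sigma_sets M {F. closedin mtopology F} = sets B"
  proof (rule antisym)
    show "sigma_sets M {F. closedin mtopology F} \<subseteq> sets B"
      using sets.top[of B] by (intro sets.sigma_sets_subset') (auto intro: closedin_sets_borel_on)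
    have "U \<in> sigma_sets M {F. closedin mtopology F}" if U: "openin mtopology U" for U
    proof -
      have "closedin mtopology (M - U)" using U closedin_diff[OF closedin_topspace U] by simp
      then have "M - (M - U) \<in> sigma_sets M {F. closedin mtopology F}"
        by (intro sigma_sets.Compl sigma_sets.Basic) auto
      moreover have "U \<subseteq> M" using openin_subset[OF U] by simp
      ultimately show ?thesis by (simp add: double_diff)
    qed
    then show "sets B \<subseteq> sigma_sets M {F. closedin mtopology F}"
      unfolding sets_borel_on topspace_mtopology by (intro sigma_sets_mono) auto
  qed
  show ?thesis
  proof (rule measure_eqI_generator_eq[where E="{F. closedin mtopology F}" and A="\<lambda>_. M" and \<Omega>=M])
    show "Int_stable {F. closedin mtopology F}" by (auto simp: Int_stable_def)
    show "{F. closedin mtopology F} \<subseteq> Pow M" using closedin_subset by fastforce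
    show "emeasure \<mu> F = emeasure \<nu> F" if "F \<in> {F. closedin mtopology F}" for F
      using closed[of F] that by (simp add: \<mu>.emeasure_eq_measure \<nu>.emeasure_eq_measure)
    show "sets \<mu> = sigma_sets M {F. closedin mtopology F}" "sets \<nu> = sigma_sets M {F. closedin mtopology F}"
      using f sc by auto
    show "range (\<lambda>_. M) \<subseteq> {F. closedin mtopology F}" using closedin_topspace[of mtopology] by auto
    show "emeasure \<mu> M \<noteq> \<infinity>" by simp
  qed auto
qed

end

section \<open>Push-forward of measures\<close>

context gen_wasserstein_space
begin

text \<open>Compare with the competitor that deletes both measures.\<close>

lemma W_le_masses:
  assumes "\<mu> \<in> \<M>" "\<nu> \<in> \<M>"
  shows "W \<mu> \<nu> \<le> a * (mass \<mu> + mass \<nu>)"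
proof -
  let ?o = "null_measure B"
  have o: "?o \<in> \<M>" by (rule null_measure_finite_measures)
  have tv: "tv_mass \<kappa> ?o \<le> mass \<kappa>" if "\<kappa> \<in> \<M>" for \<kappa>
    using tv_mass_le_masses[of \<kappa> ?o] finite_measuresD[OF that] finite_measuresD[OF o]
    by (simp add: mass_def)
  have "W \<mu> \<nu> \<le> a * tv_mass \<mu> ?o + a * tv_mass \<nu> ?o + b * 0"
    by (intro W_le_of_transport assms o transport_le_refl) simp
  also have "\<dots> \<le> a * mass \<mu> + a * mass \<nu> + b * 0"
    using a tv assms by (intro add_mono order_refl mult_left_mono) auto
  finally show ?thesis by (simp add: distrib_left)
qed

lemma mass_le_of_tv:
  assumes "\<mu> \<in> \<M>" "\<mu>' \<in> \<M>"
  shows "mass \<mu>' \<le> mass \<mu> + tv_mass \<mu> \<mu>'"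
  using mass_diff_le_tv_mass[of \<mu> \<mu>'] assms by (simp add: finite_measuresD)

text \<open>The plan is the image of \<open>\<mu>\<close> on the graph of \<open>f\<close>.\<close>

lemma distr_near_identity:
  assumes mu: "\<mu> \<in> \<M>" and C: "mass \<mu> \<le> C" and e: "e \<ge> 0"
    and f[measurable]: "f \<in> measurable B B" and near: "\<And>x. x \<in> M \<Longrightarrow> d (f x) x \<le> e"
  shows "distr \<mu> B f \<in> \<M>" "W (distr \<mu> B f) \<mu> \<le> b * (e * C powr (1 / p))"
proof -
  note fd = finite_measuresD[OF mu]
  interpret finite_measure \<mu> by (rule fd)
  note [measurable_cong] = fd(1)
  have f': "f \<in> measurable \<mu> B" by measurable
  show 1: "distr \<mu> B f \<in> \<M>" by (intro finite_measuresI finite_measure_distr f') simp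
  have C0: "C \<ge> 0" using C by (simp add: mass_def order_trans[OF measure_nonneg])
  have M: "M \<in> sets B" using sets.top[of B] by simp
  let ?\<pi> = "distr \<mu> (B \<Otimes>\<^sub>M B) (\<lambda>x. (f x, x))"
  have fM: "f x \<in> M" if "x \<in> M" for x using measurable_space[OF f, of x] that by simp
  have "plan M d (distr \<mu> B f) \<mu> ?\<pi>"
  proof (rule planI)
    fix A assume A: "A \<in> sets B"
    have AM: "A \<subseteq> M" using sets.sets_into_space[OF A] by simp
    have "(\<lambda>x. (f x, x)) -` (A \<times> M) \<inter> space \<mu> = f -` A \<inter> space \<mu>" using fd by auto
    then show "emeasure ?\<pi> (A \<times> M) = emeasure (distr \<mu> B f) A"
      using A M by (simp add: emeasure_distr)
    have "(\<lambda>x. (f x, x)) -` (M \<times> A) \<inter> space \<mu> = A" using fd AM fM by auto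
    then show "emeasure ?\<pi> (M \<times> A) = emeasure \<mu> A" using A M by (simp add: emeasure_distr)
  qed (use fd in auto)
  moreover have "cost ?\<pi> \<le> ennreal ((e * C powr (1 / p)) powr p)"
  proof -
    have "cost ?\<pi> = (\<integral>\<^sup>+x. ennreal (d (f x) x powr p) \<partial>\<mu>)"
      by (subst nn_integral_distr) auto
    also have "\<dots> \<le> (\<integral>\<^sup>+x. ennreal (e powr p) \<partial>\<mu>)"
      using near p fd by (intro nn_integral_mono) (auto intro!: ennreal_leI powr_mono2)
    also have "\<dots> = ennreal (e powr p * mass \<mu>)"
      by (simp add: emeasure_eq_measure mass_def ennreal_mult)
    also have "\<dots> \<le> ennreal (e powr p * C)" by (intro ennreal_leI mult_left_mono C) simp
    also have "e powr p * C = (e * C powr (1 / p)) powr p"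
      using p C0 by (simp add: powr_mult powr_powr)
    finally show ?thesis .
  qed
  ultimately have "transport_le M d p (e * C powr (1 / p)) (distr \<mu> B f) \<mu>"
    unfolding transport_le_def by blast
  from W_le_of_transport[OF 1 mu 1 mu this] e
  show "W (distr \<mu> B f) \<mu> \<le> b * (e * C powr (1 / p))" by simp
qed

lemma measures_p_le_eq: "measures_p_le M d p C = {\<mu> \<in> \<M>. mass \<mu> \<le> C}"
  by (simp add: measures_p_le_def measures_p_eq)

text \<open>The predicate \<^const>\<open>Metric_space\<close> asks for nonnegativity and symmetry on the whole type, so the
  distance is set to \<open>0\<close> off the carrier.\<close>

lemma Metric_space_W:
  assumes "S \<subseteq> \<M>"
  shows "Metric_space S (\<lambda>\<mu> \<nu>. if \<mu> \<in> S \<and> \<nu> \<in> S then W \<mu> \<nu> else 0)"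
proof
  fix \<mu> \<nu>
  show "0 \<le> (if \<mu> \<in> S \<and> \<nu> \<in> S then W \<mu> \<nu> else 0)" using assms by (auto intro: W_nonneg)
  show "(if \<mu> \<in> S \<and> \<nu> \<in> S then W \<mu> \<nu> else 0) = (if \<nu> \<in> S \<and> \<mu> \<in> S then W \<nu> \<mu> else 0)"
    using assms W_commute by auto
next
  fix \<mu> \<nu> assume "\<mu> \<in> S" "\<nu> \<in> S"
  then show "((if \<mu> \<in> S \<and> \<nu> \<in> S then W \<mu> \<nu> else 0) = 0) = (\<mu> = \<nu>)"
    using assms W_zero_imp_eq[of \<mu> \<nu>] W_refl[of \<mu>] by auto
next
  fix \<mu> \<nu> \<eta> assume "\<mu> \<in> S" "\<nu> \<in> S" "\<eta> \<in> S"
  then show "(if \<mu> \<in> S \<and> \<eta> \<in> S then W \<mu> \<eta> else 0)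
      \<le> (if \<mu> \<in> S \<and> \<nu> \<in> S then W \<mu> \<nu> else 0) + (if \<nu> \<in> S \<and> \<eta> \<in> S then W \<nu> \<eta> else 0)"
    using assms W_triangle[of \<mu> \<nu> \<eta>] by auto
qed

end

text \<open>The image under \<open>T\<close> of a competitor is a competitor. Its plan costs more by the \<open>L\<^sup>p\<close> norm of the
  constant \<open>e\<close>, which depends on the mass transported. Since the distance is at most
  \<open>2 * a * C\<close>, a competitor within \<open>a * C\<close> of the optimum has total variation cost
  at most \<open>3 * a * C\<close>; hence it transports mass at most \<open>C + 3 * C\<close>.\<close>

lemma W_distr_le:
  fixes X :: "'a set" and Y :: "'b set"
  assumes "gen_wasserstein_space X dX p a b" "gen_wasserstein_space Y dY p a b"
    and T: "T \<in> measurable (borel_on (Metric_space.mtopology X dX)) (borel_on (Metric_space.mtopology Y dY))"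
    and exp: "\<And>x y. x \<in> X \<Longrightarrow> y \<in> X \<Longrightarrow> dY (T x) (T y) \<le> dX x y + e" and e: "e > 0"
    and mu: "\<mu> \<in> finite_measures X dX" "\<nu> \<in> finite_measures X dX"
    and C: "C > 0" "mass \<mu> \<le> C" "mass \<nu> \<le> C"
  shows "gen_wasserstein Y dY p a b
           (distr \<mu> (borel_on (Metric_space.mtopology Y dY)) T)
           (distr \<nu> (borel_on (Metric_space.mtopology Y dY)) T)
         \<le> gen_wasserstein X dX p a b \<mu> \<nu> + b * (e * (4 * C) powr (1 / p))"
proof -
  interpret X: gen_wasserstein_space X dX p a b by fact
  interpret Y: gen_wasserstein_space Y dY p a b by fact
  note [measurable] = T
  have TY: "T x \<in> Y" if "x \<in> X" for x using measurable_space[OF T] that by simp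
  have push: "distr \<kappa> Y.B T \<in> Y.\<M>" if "\<kappa> \<in> X.\<M>" for \<kappa>
  proof -
    note fd = X.finite_measuresD[OF that]
    note [measurable_cong] = fd(1)
    interpret finite_measure \<kappa> by (rule fd)
    show ?thesis by (intro Y.finite_measuresI finite_measure_distr) auto
  qed
  have tv: "tv_mass (distr \<kappa> Y.B T) (distr \<kappa>' Y.B T) \<le> tv_mass \<kappa> \<kappa>'" if "\<kappa> \<in> X.\<M>" "\<kappa>' \<in> X.\<M>" for \<kappa> \<kappa>'
    using X.finite_measuresD[OF that(1)] X.finite_measuresD[OF that(2)] T
    by (intro tv_mass_distr_le) (simp_all cong: measurable_cong_sets)
  have transport: "transport_le Y dY p (A + e * (4 * C) powr (1 / p)) (distr \<mu>' Y.B T) (distr \<nu>' Y.B T)"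
    if t: "transport_le X dX p A \<mu>' \<nu>'" and A: "A > 0" and mu': "\<mu>' \<in> X.\<M>" "mass \<mu>' \<le> 4 * C"
    for A \<mu>' \<nu>'
  proof -
    note fd = X.finite_measuresD[OF mu'(1)]
    obtain \<pi> where pl: "plan X dX \<mu>' \<nu>' \<pi>" and c: "X.cost \<pi> \<le> ennreal (A powr p)"
      using t by (auto simp: transport_le_def)
    interpret \<mu>': finite_measure \<mu>' by (rule fd)
    interpret \<pi>: finite_measure \<pi> by (rule X.plan_finite[OF pl]) unfold_locales
    note [measurable_cong] = X.planD(1)[OF pl]
    let ?\<pi> = "distr \<pi> (Y.B \<Otimes>\<^sub>M Y.B) (\<lambda>z. (T (fst z), T (snd z)))"
    have "plan Y dY (distr \<mu>' Y.B T) (distr \<nu>' Y.B T) ?\<pi>"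
      unfolding plan_def X.planD(3)[OF pl, symmetric] X.planD(4)[OF pl, symmetric]
      by (simp add: distr_distr comp_def)
    moreover have "Y.cost ?\<pi> \<le> ennreal ((A + e * (4 * C) powr (1 / p)) powr p)"
    proof -
      have "Y.cost ?\<pi> = (\<integral>\<^sup>+z. ennreal (dY (T (fst z)) (T (snd z)) powr p) \<partial>\<pi>)"
        by (subst nn_integral_distr) auto
      also have "\<dots> \<le> (\<integral>\<^sup>+z. ennreal ((dX (fst z) (snd z) + e) powr p) \<partial>\<pi>)"
        using exp X.p X.planD(2)[OF pl] by (intro nn_integral_mono) (auto intro!: ennreal_leI powr_mono2)
      also have "\<dots> \<le> ennreal ((A + e * (4 * C) powr (1 / p)) powr p)"
      proof (rule Minkowski_powr_bound)
        have "(\<integral>\<^sup>+z. ennreal (e powr p) \<partial>\<pi>) = ennreal (e powr p * mass \<mu>')"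
          using X.plan_marginals(5)[OF pl] X.planD(2)[OF pl] fd(2)
          by (simp add: mass_def \<mu>'.emeasure_eq_measure ennreal_mult)
        also have "\<dots> \<le> ennreal (e powr p * (4 * C))" by (intro ennreal_leI mult_left_mono mu') simp
        also have "e powr p * (4 * C) = (e * (4 * C) powr (1 / p)) powr p"
          using X.p C by (simp add: powr_mult powr_powr)
        finally show "(\<integral>\<^sup>+z. ennreal (e powr p) \<partial>\<pi>) \<le> ennreal ((e * (4 * C) powr (1 / p)) powr p)" .
      qed (use A e C X.p c in auto)
      finally show ?thesis .
    qed
    ultimately show ?thesis unfolding transport_le_def by blast
  qed
  show ?thesis
  proof (rule field_le_epsilon)
    fix \<epsilon> :: real assume \<epsilon>: "\<epsilon> > 0"
    define \<delta> where "\<delta> = min \<epsilon> (a * C)"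
    have \<delta>: "\<delta> > 0" "\<delta> \<le> \<epsilon>" "\<delta> \<le> a * C" using \<epsilon> X.a C by (auto simp: \<delta>_def)
    obtain \<mu>' \<nu>' A where h: "\<mu>' \<in> X.\<M>" "\<nu>' \<in> X.\<M>" "transport_le X dX p A \<mu>' \<nu>'" "A > 0"
      "a * tv_mass \<mu> \<mu>' + a * tv_mass \<nu> \<nu>' + b * A < X.W \<mu> \<nu> + \<delta>"
      using X.W_lessE[OF mu, of "X.W \<mu> \<nu> + \<delta>"] \<delta> by auto
    have "mass \<mu>' \<le> 4 * C"
    proof -
      have "a * (mass \<mu> + mass \<nu>) \<le> a * (2 * C)" using X.a C by (intro mult_left_mono) auto
      then have "X.W \<mu> \<nu> + \<delta> \<le> a * (3 * C)" using X.W_le_masses[OF mu] \<delta>(3) by linarith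
      moreover have "0 \<le> a * tv_mass \<nu> \<nu>'" "0 \<le> b * A"
        using X.a X.b h(4) X.tv_nonneg[OF mu(2) h(2)] by simp_all
      ultimately have "a * tv_mass \<mu> \<mu>' \<le> a * (3 * C)" using h(5) by linarith
      then have "tv_mass \<mu> \<mu>' \<le> 3 * C" using X.a by (simp only: mult_le_cancel_left_pos)
      then show ?thesis using X.mass_le_of_tv[OF mu(1) h(1)] C by linarith
    qed
    then have "Y.W (distr \<mu> Y.B T) (distr \<nu> Y.B T)
        \<le> a * tv_mass (distr \<mu> Y.B T) (distr \<mu>' Y.B T) + a * tv_mass (distr \<nu> Y.B T) (distr \<nu>' Y.B T)
          + b * (A + e * (4 * C) powr (1 / p))"
      using e h(4) by (intro Y.W_le_of_transport push mu h transport) auto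
    also have "\<dots> \<le> a * tv_mass \<mu> \<mu>' + a * tv_mass \<nu> \<nu>' + b * (A + e * (4 * C) powr (1 / p))"
      using X.a by (intro add_mono order_refl mult_left_mono tv mu h) auto
    also have "\<dots> = a * tv_mass \<mu> \<mu>' + a * tv_mass \<nu> \<nu>' + b * A + b * (e * (4 * C) powr (1 / p))"
      by (simp add: distrib_left)
    finally show "Y.W (distr \<mu> Y.B T) (distr \<nu> Y.B T)
        \<le> X.W \<mu> \<nu> + b * (e * (4 * C) powr (1 / p)) + \<epsilon>"
      using h(5) \<delta>(2) by linarith
  qed
qed

section \<open>Gromov-Hausdorff distance and approximate isometries\<close>

lemma GH_dist_cong:
  fixes A :: "'a set" and B :: "'b set"
  assumes "\<And>x x'. x \<in> A \<Longrightarrow> x' \<in> A \<Longrightarrow> \<alpha> x x' = \<alpha>' x x'"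
    and "\<And>y y'. y \<in> B \<Longrightarrow> y' \<in> B \<Longrightarrow> \<beta> y y' = \<beta>' y y'"
  shows "GH_dist A \<alpha> B \<beta> = GH_dist A \<alpha>' B \<beta>'"
proof -
  have "isometric A \<alpha> (Q :: ('a + 'b) set) \<rho> = isometric A \<alpha>' Q \<rho>"
    "isometric B \<beta> (Q :: ('a + 'b) set) \<rho> = isometric B \<beta>' Q \<rho>" for Q \<rho>
    using assms by (auto simp: isometric_def)
  then show ?thesis by (simp add: GH_dist_def)
qed

text \<open>The ambient space is the disjoint union, in which \<open>x\<close> reaches \<open>y\<close> by walking to some
  \<open>u\<close>, jumping to \<open>\<Phi> u\<close> at the price \<open>\<epsilon>\<close>, and walking on to \<open>y\<close>. Crossing over and back costs at
  least \<open>2 * \<epsilon>\<close>, more than the distortion of \<open>\<Phi>\<close>, so the jumps create no short cuts and the given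
  distances are kept.\<close>

lemma GH_dist_le_of_approximation:
  fixes A :: "'a set" and B :: "'b set"
  assumes A: "Metric_space A \<alpha>" and B: "Metric_space B \<beta>" and ne: "A \<noteq> {}" and \<epsilon>: "\<epsilon> > 0"
    and \<Phi>: "\<And>x. x \<in> A \<Longrightarrow> \<Phi> x \<in> B"
    and dist: "\<And>x x'. x \<in> A \<Longrightarrow> x' \<in> A \<Longrightarrow> \<bar>\<beta> (\<Phi> x) (\<Phi> x') - \<alpha> x x'\<bar> \<le> \<epsilon>"
    and dense: "\<And>y. y \<in> B \<Longrightarrow> \<exists>x\<in>A. \<beta> (\<Phi> x) y \<le> \<epsilon>"
  shows "GH_dist A \<alpha> B \<beta> \<le> ennreal (4 * \<epsilon>)"
proof -
  interpret A: Metric_space A \<alpha> by (rule A)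
  interpret B: Metric_space B \<beta> by (rule B)
  define \<theta> where "\<theta> = (\<lambda>x y. (INF u\<in>A. \<alpha> x u + \<beta> (\<Phi> u) y) + \<epsilon>)"
  have bdd: "bdd_below ((\<lambda>u. \<alpha> x u + \<beta> (\<Phi> u) y) ` A)" for x y
    by (intro bdd_belowI[of _ 0]) auto
  have \<theta>_le: "\<theta> x y \<le> \<alpha> x u + \<beta> (\<Phi> u) y + \<epsilon>" if "u \<in> A" for x y u
    unfolding \<theta>_def using cINF_lower[OF bdd that] by simp
  have le_\<theta>: "t \<le> \<theta> x y" if "\<And>u. u \<in> A \<Longrightarrow> t \<le> \<alpha> x u + \<beta> (\<Phi> u) y + \<epsilon>" for t x y
  proof -
    have "t - \<epsilon> \<le> (INF u\<in>A. \<alpha> x u + \<beta> (\<Phi> u) y)"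
      by (rule cINF_greatest[OF ne]) (use that in \<open>simp add: algebra_simps\<close>)
    then show ?thesis by (simp add: \<theta>_def)
  qed
  have \<theta>_ge: "\<epsilon> \<le> \<theta> x y" for x y by (rule le_\<theta>) simp
  define \<rho> where "\<rho> = (\<lambda>s t. case s of
      Inl x \<Rightarrow> (case t of Inl x' \<Rightarrow> \<alpha> x x' | Inr y \<Rightarrow> \<theta> x y)
    | Inr y \<Rightarrow> (case t of Inl x \<Rightarrow> \<theta> x y | Inr y' \<Rightarrow> \<beta> y y'))"
  have \<rho>: "\<rho> (Inl x) (Inl x') = \<alpha> x x'" "\<rho> (Inl x) (Inr y) = \<theta> x y"
    "\<rho> (Inr y) (Inl x) = \<theta> x y" "\<rho> (Inr y) (Inr y') = \<beta> y y'" for x x' y y'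
    by (simp_all add: \<rho>_def)
  have t1: "\<theta> x y \<le> \<alpha> x x' + \<theta> x' y" if "x \<in> A" "x' \<in> A" for x x' y
  proof -
    have "\<theta> x y - \<alpha> x x' \<le> \<theta> x' y"
    proof (rule le_\<theta>)
      fix u assume u: "u \<in> A"
      show "\<theta> x y - \<alpha> x x' \<le> \<alpha> x' u + \<beta> (\<Phi> u) y + \<epsilon>"
        using \<theta>_le[OF u, of x y] A.triangle[OF that u] by linarith
    qed
    then show ?thesis by linarith
  qed
  have t2: "\<theta> x y \<le> \<theta> x y' + \<beta> y' y" if "y \<in> B" "y' \<in> B" for x y y'
  proof -
    have "\<theta> x y - \<beta> y' y \<le> \<theta> x y'"
    proof (rule le_\<theta>)
      fix u assume u: "u \<in> A"
      show "\<theta> x y - \<beta> y' y \<le> \<alpha> x u + \<beta> (\<Phi> u) y' + \<epsilon>"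
        using \<theta>_le[OF u, of x y] B.triangle[OF \<Phi>[OF u] that(2,1)] by linarith
    qed
    then show ?thesis by linarith
  qed
  have t3: "\<alpha> x x' \<le> \<theta> x y + \<theta> x' y" if "x \<in> A" "x' \<in> A" "y \<in> B" for x x' y
  proof -
    have "\<alpha> x x' - \<theta> x' y \<le> \<theta> x y"
    proof (rule le_\<theta>)
      fix u assume u: "u \<in> A"
      have "\<alpha> x x' - (\<alpha> x u + \<beta> (\<Phi> u) y + \<epsilon>) \<le> \<theta> x' y"
      proof (rule le_\<theta>)
        fix v assume v: "v \<in> A"
        have "\<alpha> x x' \<le> \<alpha> x u + \<alpha> u v + \<alpha> x' v"
          using A.triangle[OF that(1) u that(2)] A.triangle'[OF u v that(2)] by linarith
        moreover have "\<beta> (\<Phi> u) (\<Phi> v) \<le> \<beta> (\<Phi> u) y + \<beta> (\<Phi> v) y"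
          by (rule B.triangle'[OF \<Phi>[OF u] that(3) \<Phi>[OF v]])
        ultimately show "\<alpha> x x' - (\<alpha> x u + \<beta> (\<Phi> u) y + \<epsilon>) \<le> \<alpha> x' v + \<beta> (\<Phi> v) y + \<epsilon>"
          using dist[OF u v] \<epsilon> by linarith
      qed
      then show "\<alpha> x x' - \<theta> x' y \<le> \<alpha> x u + \<beta> (\<Phi> u) y + \<epsilon>" by linarith
    qed
    then show ?thesis by linarith
  qed
  have t4: "\<beta> y y' \<le> \<theta> x y + \<theta> x y'" if "x \<in> A" "y \<in> B" "y' \<in> B" for x y y'
  proof -
    have "\<beta> y y' - \<theta> x y' \<le> \<theta> x y"
    proof (rule le_\<theta>)
      fix u assume u: "u \<in> A"
      have "\<beta> y y' - (\<alpha> x u + \<beta> (\<Phi> u) y + \<epsilon>) \<le> \<theta> x y'"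
      proof (rule le_\<theta>)
        fix v assume v: "v \<in> A"
        have "\<beta> y y' \<le> \<beta> (\<Phi> u) y + \<beta> (\<Phi> u) (\<Phi> v) + \<beta> (\<Phi> v) y'"
          using B.triangle''[OF that(2) \<Phi>[OF u] that(3)] B.triangle[OF \<Phi>[OF u] \<Phi>[OF v] that(3)]
          by linarith
        moreover have "\<alpha> u v \<le> \<alpha> x u + \<alpha> x v"
          by (rule A.triangle''[OF u that(1) v])
        ultimately show "\<beta> y y' - (\<alpha> x u + \<beta> (\<Phi> u) y + \<epsilon>) \<le> \<alpha> x v + \<beta> (\<Phi> v) y' + \<epsilon>"
          using dist[OF u v] \<epsilon> by linarith
      qed
      then show "\<beta> y y' - \<theta> x y' \<le> \<alpha> x u + \<beta> (\<Phi> u) y + \<epsilon>" by linarith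
    qed
    then show ?thesis by linarith
  qed
  have t5: "\<theta> x y \<le> \<theta> x' y + \<alpha> x' x" if "x \<in> A" "x' \<in> A" for x x' y
    using t1[OF that, of y] A.commute[of x x'] by simp
  have t6: "\<theta> x y \<le> \<beta> y y' + \<theta> x y'" if "y \<in> B" "y' \<in> B" for x y y'
    using t2[OF that, of x] B.commute[of y y'] by simp
  have Z: "Metric_space (A <+> B) \<rho>"
  proof
    fix s t :: "'a + 'b"
    show "0 \<le> \<rho> s t" using \<theta>_ge \<epsilon> by (cases s; cases t) (auto simp: \<rho> intro: order_trans[of 0 \<epsilon>])
    show "\<rho> s t = \<rho> t s" by (cases s; cases t) (auto simp: \<rho> A.commute B.commute)
  next
    fix s t assume st: "s \<in> A <+> B" "t \<in> A <+> B"
    have "\<theta> x y \<noteq> 0" for x y using \<theta>_ge[of x y] \<epsilon> by simp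
    then show "(\<rho> s t = 0) = (s = t)" using st by (auto simp: \<rho>)
  next
    fix s t r assume "s \<in> A <+> B" "t \<in> A <+> B" "r \<in> A <+> B"
    then show "\<rho> s r \<le> \<rho> s t + \<rho> t r"
      by (elim PlusE) (auto simp: \<rho> intro: t1 t2 t3 t4 t5 t6 A.triangle B.triangle)
  qed
  then interpret Z: Metric_space "A <+> B" \<rho> .
  have isoA: "isometric A \<alpha> (Inl ` A) \<rho>"
    unfolding isometric_def by (intro exI[of _ Inl]) (auto simp: \<rho> bij_betw_def)
  have isoB: "isometric B \<beta> (Inr ` B) \<rho>"
    unfolding isometric_def by (intro exI[of _ Inr]) (auto simp: \<rho> bij_betw_def)
  have "Inl ` A \<subseteq> nbhd (A <+> B) \<rho> (3 * \<epsilon>) (Inr ` B)"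
  proof safe
    fix x assume x: "x \<in> A"
    have "\<theta> x (\<Phi> x) < 3 * \<epsilon>" using \<theta>_le[OF x, of x "\<Phi> x"] x \<Phi>[OF x] \<epsilon> by simp
    then show "Inl x \<in> nbhd (A <+> B) \<rho> (3 * \<epsilon>) (Inr ` B)"
      using x \<Phi>[OF x] by (auto simp: nbhd_def \<rho> intro!: bexI[of _ "\<Phi> x"])
  qed
  moreover have "Inr ` B \<subseteq> nbhd (A <+> B) \<rho> (3 * \<epsilon>) (Inl ` A)"
  proof safe
    fix y assume y: "y \<in> B"
    obtain x where x: "x \<in> A" "\<beta> (\<Phi> x) y \<le> \<epsilon>" using dense[OF y] by blast
    have "\<theta> x y < 3 * \<epsilon>" using \<theta>_le[OF x(1), of x y] x \<epsilon> by simp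
    then show "Inr y \<in> nbhd (A <+> B) \<rho> (3 * \<epsilon>) (Inl ` A)"
      using x y by (auto simp: nbhd_def \<rho> intro!: bexI[of _ x])
  qed
  ultimately have "hausdorff_dist (A <+> B) \<rho> (Inl ` A) (Inr ` B) \<le> ennreal (3 * \<epsilon>)"
    unfolding hausdorff_dist_def using \<epsilon> by (intro Inf_lower imageI) simp
  also have "\<dots> < ennreal (4 * \<epsilon>)" using \<epsilon> by (simp add: ennreal_less_iff)
  finally show ?thesis
    using \<epsilon> by (intro GH_dist_le[OF Z _ _ isoA isoB]) auto
qed

text \<open>With all of \<open>Y\<close> as range, a point at distance less than \<open>r\<close> exists; doubling the
  radius leaves room to choose it in a countable dense subset, where the choice is measurable.\<close>

lemma measurable_close_point_map:
  fixes X :: "'a set" and Y :: "'b set" and Z :: "'c set"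
  assumes "separable_metric X dX" "separable_metric Y dY" "Metric_space Z \<rho>" and r: "r > 0"
    and f: "\<And>x. x \<in> X \<Longrightarrow> f x \<in> Z" "\<And>x x'. x \<in> X \<Longrightarrow> x' \<in> X \<Longrightarrow> \<rho> (f x) (f x') = dX x x'"
    and g: "\<And>y. y \<in> Y \<Longrightarrow> g y \<in> Z" "\<And>y y'. y \<in> Y \<Longrightarrow> y' \<in> Y \<Longrightarrow> \<rho> (g y) (g y') = dY y y'"
    and near: "\<And>x. x \<in> X \<Longrightarrow> \<exists>y\<in>Y. \<rho> (f x) (g y) < r"
  obtains T where
    "T \<in> measurable (borel_on (Metric_space.mtopology X dX)) (borel_on (Metric_space.mtopology Y dY))"
    "\<And>x. x \<in> X \<Longrightarrow> \<rho> (f x) (g (T x)) < 2 * r"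
proof -
  interpret X: separable_metric X dX by fact
  interpret Y: separable_metric Y dY by fact
  interpret Z: Metric_space Z \<rho> by fact
  obtain D where D: "countable D" "D \<subseteq> Y" "\<And>y e. y \<in> Y \<Longrightarrow> 0 < e \<Longrightarrow> \<exists>q\<in>D. dY q y < e"
    by (rule Y.obtain_countable_dense) blast
  let ?P = "\<lambda>q x. \<rho> (f x) (g q) < 2 * r"
  have "{x \<in> space X.B. ?P q x} \<in> sets X.B" if q: "q \<in> D" for q
  proof (rule openin_sets_borel_on)
    have gq: "g q \<in> Z" using g(1) q D(2) by auto
    show "openin X.mtopology {x \<in> space X.B. ?P q x}"
      unfolding X.openin_mtopology
    proof (intro conjI allI impI)
      fix x assume x: "x \<in> {x \<in> space X.B. ?P q x}"
      define s where "s = 2 * r - \<rho> (f x) (g q)"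
      have "?P q x'" if "x' \<in> X.mball x s" for x'
      proof -
        have "x' \<in> X" "x \<in> X" "dX x x' < s" using that x by auto
        then show ?thesis
          using Z.triangle[OF f(1)[of x'] f(1)[of x] gq] f(2)[of x' x] X.commute[of x x']
          by (simp add: s_def)
      qed
      then have "X.mball x s \<subseteq> {x \<in> space X.B. ?P q x}" by auto
      moreover have "s > 0" using x by (simp add: s_def)
      ultimately show "\<exists>s>0. X.mball x s \<subseteq> {x \<in> space X.B. ?P q x}" by blast
    qed auto
  qed
  moreover have "\<exists>q\<in>D. ?P q x" if "x \<in> space X.B" for x
  proof -
    have x: "x \<in> X" using that by simp
    obtain y where y: "y \<in> Y" "\<rho> (f x) (g y) < r" using near[OF x] by blast
    obtain q where q: "q \<in> D" "dY q y < r" using D(3)[OF y(1) r] by blast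
    have qY: "q \<in> Y" using q(1) D(2) by auto
    have "?P q x"
      using Z.triangle[OF f(1)[OF x] g(1)[OF y(1)] g(1)[OF qY]] g(2)[OF y(1) qY] y(2) q(2)
        Y.commute[of q y] by linarith
    then show ?thesis using q(1) by blast
  qed
  ultimately obtain h where h: "h \<in> measurable X.B (count_space (UNIV :: nat set))"
    and hP: "\<forall>x\<in>space X.B. from_nat_into D (h x) \<in> D \<and> ?P (from_nat_into D (h x)) x"
    using measurable_countable_index[OF D(1), of X.B ?P] by blast
  define T where "T = (\<lambda>x. from_nat_into D (h x))"
  have "T \<in> measurable X.B Y.B"
  proof (rule measurable_borel_onI)
    show "T \<in> space X.B \<rightarrow> topspace Y.mtopology" using hP D(2) by (auto simp: T_def)
    fix U
    have "T -` U \<inter> space X.B = h -` (from_nat_into D -` U) \<inter> space X.B" by (auto simp: T_def)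
    then show "T -` U \<inter> space X.B \<in> sets X.B" using measurable_sets[OF h] by simp
  qed
  with hP show thesis by (intro that[of T]) (auto simp: T_def)
qed

section \<open>Convergence of the spaces of measures\<close>

text \<open>The push-forward by \<open>T\<close> expands distances by at most \<open>k\<close>, and so does the push-forward by \<open>S\<close>. The
  composition moves every measure by at most \<open>k\<close>, so the push-forward by \<open>T\<close> contracts a distance by
  at most \<open>3 * k\<close>: one \<open>k\<close> from \<open>S\<close> and two from the endpoints.\<close>

lemma GH_dist_measure_spaces_le_maps:
  fixes X :: "'a set" and Y :: "'b set"
  assumes "gen_wasserstein_space X dX p a b" "gen_wasserstein_space Y dY p a b" and C: "C > 0" and e: "e > 0"
    and T: "T \<in> measurable (borel_on (Metric_space.mtopology X dX)) (borel_on (Metric_space.mtopology Y dY))"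
    and S: "S \<in> measurable (borel_on (Metric_space.mtopology Y dY)) (borel_on (Metric_space.mtopology X dX))"
    and Te: "\<And>x x'. x \<in> X \<Longrightarrow> x' \<in> X \<Longrightarrow> dY (T x) (T x') \<le> dX x x' + e"
    and Se: "\<And>y y'. y \<in> Y \<Longrightarrow> y' \<in> Y \<Longrightarrow> dX (S y) (S y') \<le> dY y y' + e"
    and ST: "\<And>x. x \<in> X \<Longrightarrow> dX (S (T x)) x \<le> e"
    and TS: "\<And>y. y \<in> Y \<Longrightarrow> dY (T (S y)) y \<le> e"
  shows "GH_dist (measures_p_le X dX p C) (gen_wasserstein X dX p a b)
                 (measures_p_le Y dY p C) (gen_wasserstein Y dY p a b)
         \<le> ennreal (12 * b * (4 * C) powr (1 / p) * e)"
proof -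
  interpret X: gen_wasserstein_space X dX p a b by fact
  interpret Y: gen_wasserstein_space Y dY p a b by fact
  note [measurable] = T S
  define k where "k = b * (e * (4 * C) powr (1 / p))"
  have k: "k > 0" using X.b e C by (simp add: k_def)
  let ?A = "measures_p_le X dX p C" and ?B = "measures_p_le Y dY p C"
  have AD: "\<mu> \<in> X.\<M>" "mass \<mu> \<le> C" if "\<mu> \<in> ?A" for \<mu> using that by (simp_all add: X.measures_p_le_eq)
  have BD: "\<nu> \<in> Y.\<M>" "mass \<nu> \<le> C" if "\<nu> \<in> ?B" for \<nu> using that by (simp_all add: Y.measures_p_le_eq)
  have pushT: "distr \<mu> Y.B T \<in> ?B" if "\<mu> \<in> ?A" for \<mu>
  proof -
    note fd = X.finite_measuresD[OF AD(1)[OF that]]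
    note [measurable_cong] = fd(1)
    interpret finite_measure \<mu> by (rule fd)
    have T': "T \<in> measurable \<mu> Y.B" by measurable
    have "T -` Y \<inter> space \<mu> = space \<mu>" using measurable_space[OF T'] by auto
    then have "mass (distr \<mu> Y.B T) = mass \<mu>"
      using sets.top[of Y.B] by (simp add: mass_def measure_distr[OF T'])
    then show ?thesis
      using AD(2)[OF that] finite_measure_distr[OF T']
      by (simp add: Y.measures_p_le_eq Y.finite_measuresI)
  qed
  have pushS: "distr \<nu> X.B S \<in> ?A" if "\<nu> \<in> ?B" for \<nu>
  proof -
    note fd = Y.finite_measuresD[OF BD(1)[OF that]]
    note [measurable_cong] = fd(1)
    interpret finite_measure \<nu> by (rule fd)
    have S': "S \<in> measurable \<nu> X.B" by measurable
    have "S -` X \<inter> space \<nu> = space \<nu>" using measurable_space[OF S'] by auto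
    then have "mass (distr \<nu> X.B S) = mass \<nu>"
      using sets.top[of X.B] by (simp add: mass_def measure_distr[OF S'])
    then show ?thesis
      using BD(2)[OF that] finite_measure_distr[OF S']
      by (simp add: X.measures_p_le_eq X.finite_measuresI)
  qed
  have mono: "b * (e * C powr (1 / p)) \<le> k"
    unfolding k_def using X.b e C X.p by (intro mult_left_mono powr_mono2) auto
  have nearX: "X.W (distr (distr \<mu> Y.B T) X.B S) \<mu> \<le> k" if "\<mu> \<in> ?A" for \<mu>
  proof -
    note [measurable_cong] = X.finite_measuresD(1)[OF AD(1)[OF that]]
    have "distr (distr \<mu> Y.B T) X.B S = distr \<mu> X.B (S \<circ> T)"
      by (rule distr_distr) measurable
    moreover have "X.W (distr \<mu> X.B (S \<circ> T)) \<mu> \<le> b * (e * C powr (1 / p))"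
      by (rule X.distr_near_identity[OF AD[OF that]]) (use e ST in \<open>auto intro!: measurable_comp[OF T S]\<close>)
    ultimately show ?thesis using mono by simp
  qed
  have nearY: "Y.W (distr (distr \<nu> X.B S) Y.B T) \<nu> \<le> k" if "\<nu> \<in> ?B" for \<nu>
  proof -
    note [measurable_cong] = Y.finite_measuresD(1)[OF BD(1)[OF that]]
    have "distr (distr \<nu> X.B S) Y.B T = distr \<nu> Y.B (T \<circ> S)"
      by (rule distr_distr) measurable
    moreover have "Y.W (distr \<nu> Y.B (T \<circ> S)) \<nu> \<le> b * (e * C powr (1 / p))"
      by (rule Y.distr_near_identity[OF BD[OF that]]) (use e TS in \<open>auto intro!: measurable_comp[OF S T]\<close>)
    ultimately show ?thesis using mono by simp
  qed
  have distortion: "\<bar>Y.W (distr \<mu> Y.B T) (distr \<mu>' Y.B T) - X.W \<mu> \<mu>'\<bar> \<le> 3 * k"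
    if "\<mu> \<in> ?A" "\<mu>' \<in> ?A" for \<mu> \<mu>'
  proof -
    let ?T = "\<lambda>\<mu>. distr \<mu> Y.B T" and ?S = "\<lambda>\<nu>. distr \<nu> X.B S"
    have mem: "?T \<mu> \<in> ?B" "?T \<mu>' \<in> ?B" "?S (?T \<mu>) \<in> ?A" "?S (?T \<mu>') \<in> ?A"
      using pushT pushS that by auto
    have "Y.W (?T \<mu>) (?T \<mu>') \<le> X.W \<mu> \<mu>' + k" unfolding k_def
      by (rule W_distr_le[OF assms(1,2) T Te e]) (use AD that C in auto)
    moreover have "X.W (?S (?T \<mu>)) (?S (?T \<mu>')) \<le> Y.W (?T \<mu>) (?T \<mu>') + k" unfolding k_def
      by (rule W_distr_le[OF assms(2,1) S Se e]) (use BD mem C in auto)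
    moreover have "X.W \<mu> \<mu>' \<le> X.W \<mu> (?S (?T \<mu>)) + X.W (?S (?T \<mu>)) \<mu>'"
      by (intro X.W_triangle AD that mem)
    moreover have "X.W (?S (?T \<mu>)) \<mu>' \<le> X.W (?S (?T \<mu>)) (?S (?T \<mu>')) + X.W (?S (?T \<mu>')) \<mu>'"
      by (intro X.W_triangle AD that mem)
    moreover have "X.W \<mu> (?S (?T \<mu>)) = X.W (?S (?T \<mu>)) \<mu>"
      by (intro X.W_commute AD that mem)
    ultimately show ?thesis using nearX[OF that(1)] nearX[OF that(2)] k by linarith
  qed
  let ?\<alpha> = "\<lambda>\<mu> \<mu>'. if \<mu> \<in> ?A \<and> \<mu>' \<in> ?A then X.W \<mu> \<mu>' else 0"
  let ?\<beta> = "\<lambda>\<nu> \<nu>'. if \<nu> \<in> ?B \<and> \<nu>' \<in> ?B then Y.W \<nu> \<nu>' else 0"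
  have "GH_dist ?A ?\<alpha> ?B ?\<beta> \<le> ennreal (4 * (3 * k))"
  proof (rule GH_dist_le_of_approximation[where \<Phi>="\<lambda>\<mu>. distr \<mu> Y.B T"])
    show "Metric_space ?A ?\<alpha>" by (rule X.Metric_space_W) (use AD in auto)
    show "Metric_space ?B ?\<beta>" by (rule Y.Metric_space_W) (use BD in auto)
    show "?A \<noteq> {}"
      using X.null_measure_finite_measures C by (auto simp: X.measures_p_le_eq mass_def intro!: exI[of _ "null_measure X.B"])
    show "3 * k > 0" using k by simp
    show "distr \<mu> Y.B T \<in> ?B" if "\<mu> \<in> ?A" for \<mu> by (rule pushT[OF that])
    show "\<bar>?\<beta> (distr \<mu> Y.B T) (distr \<mu>' Y.B T) - ?\<alpha> \<mu> \<mu>'\<bar> \<le> 3 * k" if "\<mu> \<in> ?A" "\<mu>' \<in> ?A" for \<mu> \<mu>'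
      using distortion[OF that] pushT that by simp
    show "\<exists>\<mu>\<in>?A. ?\<beta> (distr \<mu> Y.B T) \<nu> \<le> 3 * k" if "\<nu> \<in> ?B" for \<nu>
      using nearY[OF that] pushS[OF that] k by (intro bexI[of _ "distr \<nu> X.B S"]) auto
  qed
  moreover have "GH_dist ?A ?\<alpha> ?B ?\<beta> = GH_dist ?A X.W ?B Y.W" by (rule GH_dist_cong) auto
  moreover have "4 * (3 * k) = 12 * b * (4 * C) powr (1 / p) * e" by (simp add: k_def)
  ultimately show ?thesis by (simp only:)
qed

text \<open>In the ambient space each point is within \<open>2 * r\<close> of its image under \<open>T\<close> or \<open>S\<close>. Comparing
  two distances, or following a point there and back, uses two such steps, so \<open>4 * r\<close> bounds all the
  errors.\<close>

lemma GH_dist_measure_spaces_le: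
  fixes X :: "'a set" and Y :: "'b set"
  assumes X: "gen_wasserstein_space X dX p a b" and Y: "gen_wasserstein_space Y dY p a b" and C: "C > 0"
    and GH: "GH_dist X dX Y dY < ennreal r"
  shows "GH_dist (measures_p_le X dX p C) (gen_wasserstein X dX p a b)
                 (measures_p_le Y dY p C) (gen_wasserstein Y dY p a b)
         \<le> ennreal (48 * b * (4 * C) powr (1 / p) * r)"
proof -
  interpret X: gen_wasserstein_space X dX p a b by fact
  interpret Y: gen_wasserstein_space Y dY p a b by fact
  obtain r' Z \<rho> X' Y' where r': "ennreal r' < ennreal r" "0 < r'"
    and Z: "Metric_space (Z :: ('a + 'b) set) \<rho>" and sub: "X' \<subseteq> Z" "Y' \<subseteq> Z"
    and iX: "isometric X dX X' \<rho>" and iY: "isometric Y dY Y' \<rho>"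
    and hd: "hausdorff_dist Z \<rho> X' Y' < ennreal r'"
    using GH unfolding GH_dist_def Inf_less_iff by auto
  interpret Z: Metric_space Z \<rho> by (rule Z)
  obtain \<epsilon> where \<epsilon>: "ennreal \<epsilon> < ennreal r'" "0 < \<epsilon>" "X' \<subseteq> nbhd Z \<rho> \<epsilon> Y'" "Y' \<subseteq> nbhd Z \<rho> \<epsilon> X'"
    using hd unfolding hausdorff_dist_def Inf_less_iff by auto
  have r: "\<epsilon> < r" "r > 0" using \<epsilon>(1,2) r' by (auto simp: ennreal_less_iff)
  obtain f where f: "bij_betw f X X'" "\<And>x x'. x \<in> X \<Longrightarrow> x' \<in> X \<Longrightarrow> \<rho> (f x) (f x') = dX x x'"
    using iX unfolding isometric_def by blast
  obtain g where g: "bij_betw g Y Y'" "\<And>y y'. y \<in> Y \<Longrightarrow> y' \<in> Y \<Longrightarrow> \<rho> (g y) (g y') = dY y y'"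
    using iY unfolding isometric_def by blast
  have fZ: "f x \<in> Z" "f x \<in> X'" if "x \<in> X" for x using f(1) that sub by (auto simp: bij_betw_def)
  have gZ: "g y \<in> Z" "g y \<in> Y'" if "y \<in> Y" for y using g(1) that sub by (auto simp: bij_betw_def)
  have nearX: "\<exists>y\<in>Y. \<rho> (f x) (g y) < r" if x: "x \<in> X" for x
  proof -
    obtain t where "t \<in> Y'" "\<rho> t (f x) < \<epsilon>" using \<epsilon>(3) fZ[OF x] by (auto simp: nbhd_def)
    moreover obtain y where "y \<in> Y" "t = g y" using \<open>t \<in> Y'\<close> g(1) by (auto simp: bij_betw_def)
    ultimately show ?thesis using r Z.commute[of "f x" t] by (intro bexI[of _ y]) auto
  qed
  have nearY: "\<exists>x\<in>X. \<rho> (g y) (f x) < r" if y: "y \<in> Y" for y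
  proof -
    obtain t where "t \<in> X'" "\<rho> t (g y) < \<epsilon>" using \<epsilon>(4) gZ[OF y] by (auto simp: nbhd_def)
    moreover obtain x where "x \<in> X" "t = f x" using \<open>t \<in> X'\<close> f(1) by (auto simp: bij_betw_def)
    ultimately show ?thesis using r Z.commute[of "g y" t] by (intro bexI[of _ x]) auto
  qed
  have sX: "separable_metric X dX" and sY: "separable_metric Y dY" by unfold_locales
  obtain T where T: "T \<in> measurable X.B Y.B" "\<And>x. x \<in> X \<Longrightarrow> \<rho> (f x) (g (T x)) < 2 * r"
    using measurable_close_point_map[OF sX sY Z r(2) fZ(1) f(2) gZ(1) g(2) nearX] by blast
  obtain S where S: "S \<in> measurable Y.B X.B" "\<And>y. y \<in> Y \<Longrightarrow> \<rho> (g y) (f (S y)) < 2 * r"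
    using measurable_close_point_map[OF sY sX Z r(2) gZ(1) g(2) fZ(1) f(2) nearY] by blast
  have TY: "T x \<in> Y" if "x \<in> X" for x using measurable_space[OF T(1)] that by simp
  have SX: "S y \<in> X" if "y \<in> Y" for y using measurable_space[OF S(1)] that by simp
  have "GH_dist (measures_p_le X dX p C) X.W (measures_p_le Y dY p C) Y.W
      \<le> ennreal (12 * b * (4 * C) powr (1 / p) * (4 * r))"
  proof (rule GH_dist_measure_spaces_le_maps[OF X Y C _ T(1) S(1)])
    show "4 * r > 0" using r by simp
    show "dY (T x) (T x') \<le> dX x x' + 4 * r" if x: "x \<in> X" "x' \<in> X" for x x'
      using Z.triangle''[OF gZ(1)[OF TY[OF x(1)]] fZ(1)[OF x(1)] gZ(1)[OF TY[OF x(2)]]]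
        Z.triangle[OF fZ(1)[OF x(1)] fZ(1)[OF x(2)] gZ(1)[OF TY[OF x(2)]]]
        T(2)[OF x(1)] T(2)[OF x(2)] f(2)[OF x] g(2)[OF TY[OF x(1)] TY[OF x(2)]] by linarith
    show "dX (S y) (S y') \<le> dY y y' + 4 * r" if y: "y \<in> Y" "y' \<in> Y" for y y'
      using Z.triangle''[OF fZ(1)[OF SX[OF y(1)]] gZ(1)[OF y(1)] fZ(1)[OF SX[OF y(2)]]]
        Z.triangle[OF gZ(1)[OF y(1)] gZ(1)[OF y(2)] fZ(1)[OF SX[OF y(2)]]]
        S(2)[OF y(1)] S(2)[OF y(2)] g(2)[OF y] f(2)[OF SX[OF y(1)] SX[OF y(2)]] by linarith
    show "dX (S (T x)) x \<le> 4 * r" if x: "x \<in> X" for x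
      using Z.triangle''[OF fZ(1)[OF SX[OF TY[OF x]]] gZ(1)[OF TY[OF x]] fZ(1)[OF x]]
        S(2)[OF TY[OF x]] T(2)[OF x] f(2)[OF SX[OF TY[OF x]] x] Z.commute[of "f x" "g (T x)"] by linarith
    show "dY (T (S y)) y \<le> 4 * r" if y: "y \<in> Y" for y
      using Z.triangle''[OF gZ(1)[OF TY[OF SX[OF y]]] fZ(1)[OF SX[OF y]] gZ(1)[OF y]]
        T(2)[OF SX[OF y]] S(2)[OF y] g(2)[OF TY[OF SX[OF y]] y] Z.commute[of "g y" "f (S y)"] by linarith
  qed
  then show ?thesis by (simp add: mult.assoc)
qed

lemma gen_wasserstein_space_of_bounded_polish:
  assumes "bounded_polish_metric X d" "p \<ge> 1" "a > 0" "b > 0"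
  shows "gen_wasserstein_space X d p a b"
proof -
  interpret Metric_space X d using assms(1) by (simp add: bounded_polish_metric_def)
  show ?thesis using assms by unfold_locales (simp_all add: bounded_polish_metric_def)
qed

theorem theorem1p5:
  fixes Xs :: "nat \<Rightarrow> 'a set" and ds :: "nat \<Rightarrow> 'a \<Rightarrow> 'a \<Rightarrow> real"
    and X :: "'b set" and d :: "'b \<Rightarrow> 'b \<Rightarrow> real"
    and C a b p :: real
  assumes "\<And>n. bounded_polish_metric (Xs n) (ds n)"
    and "C > 0"
    and "bounded_polish_metric X d"
    and "GH_converges Xs ds X d"
    and "a > 0" and "b > 0" and "p \<ge> 1"
  shows "GH_converges
           (\<lambda>n. measures_p_le (Xs n) (ds n) p C) (\<lambda>n. gen_wasserstein (Xs n) (ds n) p a b)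
           (measures_p_le X d p C) (gen_wasserstein X d p a b)"
  unfolding GH_converges_def
proof (rule order_tendstoI)
  let ?G = "\<lambda>n. GH_dist (measures_p_le (Xs n) (ds n) p C) (gen_wasserstein (Xs n) (ds n) p a b)
                        (measures_p_le X d p C) (gen_wasserstein X d p a b)"
  fix u :: ennreal assume "0 < u"
  then obtain c :: real where c: "c > 0" "ennreal c < u"
    using dense[of 0 u] by (metis enn2real_nonneg ennreal_cases ennreal_less_zero_iff infinity_ennreal_def less_top_ennreal not_less_iff_gr_or_eq)
  define K where "K = 48 * b * (4 * C) powr (1 / p)"
  have K: "K > 0" using assms by (simp add: K_def)
  have "\<forall>\<^sub>F n in sequentially. GH_dist (Xs n) (ds n) X d < ennreal (c / K)"
    using assms(4) c(1) K by (intro order_tendstoD(2)[of _ 0]) (simp_all add: GH_converges_def)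
  then show "\<forall>\<^sub>F n in sequentially. ?G n < u"
  proof eventually_elim
    case (elim n)
    have "?G n \<le> ennreal (K * (c / K))" unfolding K_def
      by (rule GH_dist_measure_spaces_le[OF _ _ assms(2) elim[unfolded K_def]])
         (use assms in \<open>auto intro: gen_wasserstein_space_of_bounded_polish\<close>)
    then show ?case using c K by simp
  qed
qed simp

end
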